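(* Let $(f_k)_{k\ge 2}$ be complex numbers such that, for $\lambda\in\mathbb{C}^*$, the germ $F_\lambda(z)=\lambda\bigl(z+\sum_{k\ge 2} f_k z^k\bigr)$ is defined and univalent on the unit disk $\mathbb{D}$, and let $\lambda\mapsto H_\lambda$ be its linearization. If $\alpha_0$ is a diophantine number with exponent $\tau_0\ge2$ and $\lambda_0=e^{2\pi i\alpha_0}$, then there exists $\rho>0$ such that for any pair of disks $\Delta^-\subset\mathbb{D}$ and $\Delta^+\subset\mathbb{C}\setminus\mathbb{D}$ tangent to the unit circle $\mathbb{S}^1$ at $\lambda_0$ the map $$\overline{\Delta^+\cup\Delta^-}\ni\lambda\mapsto H_\lambda\in\mathcal{H}^\infty(\mathbb{D}_\rho)$$ has a Gevrey-$\tau_0$ asymptotic expansion at $\lambda_0$.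
   Context: **Linearization.** For $\lambda\in\mathbb{C}$ not a root of unity, $H_\lambda(z)=z+\sum_{k\ge2}h_k(\lambda)z^k$ is the power series with $h_1=1$ and, for $k\ge2$, $$h_k(\lambda)=\frac{1}{\lambda^{k-1}-1}\sum_{j=2}^{k} f_j\sum_{\epsilon\in(\mathbb{Z}_+)^j,\ \epsilon_1+\dots+\epsilon_j=k}h_{\epsilon_1}(\lambda)\cdots h_{\epsilon_j}(\lambda),$$ where $\mathbb{Z}_+$ is the set of positive integers. For $\lambda\neq0$ it is the unique formal solution tangent to the identity of $F_\lambda\circ H_\lambda=H_\lambda\circ R_\lambda$, $R_\lambda(z)=\lambda z$. $\mathcal{H}^\infty(\mathbb{D}_\rho)$ is the Banach space of bounded holomorphic functions on the disk $\{|z|<\rho\}$ with the sup norm. An irrational $\alpha_0$ is diophantine with exponent $\tau_0\ge2$ if there is $\gamma>0$ with $|\alpha_0-p/q|\ge\gamma q^{-\tau_0}$ for all $p/q\in\mathbb{Q}$ ($q\ge 1$). **Gevrey expansion.** Let $\mathcal{H}$ be a Banach space and $\Delta^\pm$ disjoint open disks tangent to $\mathbb{S}^1$ at $\lambda_0$. A function $h$ with values in $\mathcal{H}$ has a Gevrey-$\tau_0$ asymptotic expansion at $\lambda_0$ (on $\Delta^+\cup\Delta^-$) if $h$ is holomorphic in $\Delta^+\cup\Delta^-$ and there are a formal series $\sum_{k\ge0}c_k\Lambda^k\in\mathcal{H}[[\Lambda]]$ and $b_1,b_2>0$ with $$\Bigl\|h(\lambda)-\sum_{k=0}^{N-1}c_k(\lambda-\lambda_0)^k\Bigr\|\le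 b_1b_2^N\,\Gamma(1+N\tau_0)\,|\lambda-\lambda_0|^N\qquad\forall N\ge0,\ \forall\lambda\in\Delta^+\cup\Delta^-,$$ where $\Gamma$ is Euler's Gamma function.
   Formalization: A single ρ for all whole disks is impossible (inner disks exhaust 𝔻, where H_λ degenerates as λ→1); instead one ρ serves every pair on the part of Δ⁺∪Δ⁻ near λ₀ (size depending on the pair), and on the full disks the radius ρ' may depend on the pair. *)

theory Defs
  imports "HOL-Complex_Analysis.Complex_Analysis"
begin

text \<open>Only the coefficients \<open>f k\<close> with \<open>k \<ge> 2\<close> of the sequence \<open>f\<close> are ever used.\<close>

definition germ :: "(nat \<Rightarrow> complex) \<Rightarrow> complex \<Rightarrow> complex fps" where
  "germ f lam = fps_const lam * Abs_fps (\<lambda>k. if k = 0 then 0 else if k = 1 then 1 else f k)"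

definition univalent_on_disk :: "complex fps \<Rightarrow> real \<Rightarrow> bool" where
  "univalent_on_disk F r \<longleftrightarrow>
     ereal r \<le> fps_conv_radius F \<and> inj_on (eval_fps F) (ball 0 r)"

definition compositions :: "nat \<Rightarrow> nat \<Rightarrow> nat list set" where
  "compositions j k = {e. length e = j \<and> (\<forall>i\<in>set e. 0 < i) \<and> sum_list e = k}"

lemma finite_compositions: "finite (compositions j k)"
proof (rule finite_subset)
  show "compositions j k \<subseteq> {e. set e \<subseteq> {..k} \<and> length e = j}"
    by (auto simp: compositions_def member_le_sum_list)
  show "finite {e. set e \<subseteq> {..k} \<and> length e = j}"
    by (rule finite_lists_length_eq) simp
qed

lemma compositions_less:
  assumes "e \<in> compositions j k" and "2 \<le> j" and "i \<in> set e"
  shows "i < k"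
proof -
  obtain xs ys where e: "e = xs @ i # ys"
    using assms(3) by (meson split_list)
  have "xs @ ys \<noteq> []"
    using assms(1,2) e by (auto simp: compositions_def)
  then obtain x where x: "x \<in> set (xs @ ys)"
    by (meson hd_in_set)
  have "0 < x"
    using x assms(1) e by (auto simp: compositions_def)
  moreover have "x \<le> sum_list (xs @ ys)"
    using x by (intro member_le_sum_list) auto
  moreover have "k = i + sum_list (xs @ ys)"
    using assms(1) e by (simp add: compositions_def)
  ultimately show ?thesis by linarith
qed

text \<open>Meaningful when \<open>lam\<close> is not a root of unity; otherwise some divisions are by zero.\<close>

function lin_coeff :: "(nat \<Rightarrow> complex) \<Rightarrow> complex \<Rightarrow> nat \<Rightarrow> complex" where
  "lin_coeff f lam k =
     (if k = 0 then 0 else if k = 1 then 1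
      else 1 / (lam ^ (k - 1) - 1) *
        (\<Sum>j=2..k. f j * (\<Sum>e\<in>compositions j k. prod_list (map (lin_coeff f lam) e))))"
  by pat_completeness auto
termination
  by (relation "Wellfounded.measure (\<lambda>(f, lam, k). k)") (auto intro: compositions_less)

declare lin_coeff.simps [simp del]

definition linearization :: "(nat \<Rightarrow> complex) \<Rightarrow> complex \<Rightarrow> complex fps" where
  "linearization f lam = Abs_fps (lin_coeff f lam)"

text \<open>
  The radius is a real variable, so the space is a carrier set and not a type. Its elements are
  total functions, of which only the values on the disk matter: \<open>Hinf_norm r\<close> is a norm up to
  identification of functions that agree on \<open>ball 0 r\<close>.
\<close>

definition Hinf :: "real \<Rightarrow> (complex \<Rightarrow> complex) set" where
  "Hinf r = {g. g holomorphic_on ball 0 r \<and> bounded (g ` ball 0 r)}"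

definition Hinf_norm :: "real \<Rightarrow> (complex \<Rightarrow> complex) \<Rightarrow> real" where
  "Hinf_norm r g = (SUP z\<in>ball 0 r. norm (g z))"

text \<open>
  The condition on the radius of convergence is not redundant, because \<open>eval_fps\<close> has arbitrary
  values where the series diverges.
\<close>

definition fps_in_Hinf :: "complex fps \<Rightarrow> real \<Rightarrow> bool" where
  "fps_in_Hinf H r \<longleftrightarrow> ereal r \<le> fps_conv_radius H \<and> eval_fps H \<in> Hinf r"

text \<open>
  In the next two definitions a complex Banach space is a set \<open>V\<close> of complex-valued functions with
  pointwise operations and norm \<open>N\<close>.
\<close>

definition vholomorphic_on ::
  "('a \<Rightarrow> complex) set \<Rightarrow> (('a \<Rightarrow> complex) \<Rightarrow> real) \<Rightarrow> (complex \<Rightarrow> 'a \<Rightarrow> complex) \<Rightarrow> complex set \<Rightarrow> bool"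
where
  "vholomorphic_on V N h S \<longleftrightarrow> h ` S \<subseteq> V \<and>
     (\<forall>lam\<in>S. \<exists>d\<in>V.
        ((\<lambda>mu. N (\<lambda>x. (h mu x - h lam x) / (mu - lam) - d x)) \<longlongrightarrow> 0) (at lam within S))"

definition gevrey_expansion ::
  "('a \<Rightarrow> complex) set \<Rightarrow> (('a \<Rightarrow> complex) \<Rightarrow> real) \<Rightarrow> real \<Rightarrow> (complex \<Rightarrow> 'a \<Rightarrow> complex)
     \<Rightarrow> complex set \<Rightarrow> complex \<Rightarrow> bool"
where
  "gevrey_expansion V N \<tau> h S lam0 \<longleftrightarrow>
     vholomorphic_on V N h S \<and>
     (\<exists>c b1 b2. range c \<subseteq> V \<and> 0 < b1 \<and> 0 < b2 \<and>
        (\<forall>n. \<forall>lam\<in>S.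
           N (\<lambda>x. h lam x - (\<Sum>k<n. c k x * (lam - lam0) ^ k))
             \<le> b1 * b2 ^ n * Gamma (1 + real n * \<tau>) * norm (lam - lam0) ^ n))"

definition diophantine :: "real \<Rightarrow> real \<Rightarrow> bool" where
  "diophantine \<tau> \<alpha> \<longleftrightarrow> \<alpha> \<notin> \<rat> \<and> 2 \<le> \<tau> \<and>
     (\<exists>\<gamma>>0. \<forall>p::int. \<forall>q::nat. 1 \<le> q \<longrightarrow>
        \<gamma> * real q powr (- \<tau>) \<le> \<bar>\<alpha> - real_of_int p / real q\<bar>)"

text \<open>
  Tangency of the boundary circle to the unit circle at \<open>lam0\<close> is expressed by saying that the two
  circles meet in \<open>lam0\<close> only; this excludes the unit disk itself as an inner disk.
\<close>

definition inner_tangent_disk :: "complex \<Rightarrow> complex set \<Rightarrow> bool" where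
  "inner_tangent_disk lam0 D \<longleftrightarrow>
     (\<exists>c r. 0 < r \<and> D = ball c r \<and> D \<subseteq> ball 0 1 \<and> sphere c r \<inter> sphere 0 1 = {lam0})"

definition outer_tangent_disk :: "complex \<Rightarrow> complex set \<Rightarrow> bool" where
  "outer_tangent_disk lam0 D \<longleftrightarrow>
     (\<exists>c r. 0 < r \<and> D = ball c r \<and> D \<subseteq> - ball 0 1 \<and> sphere c r \<inter> sphere 0 1 = {lam0})"

text \<open>
  The closure is the closure of a domain \<open>S\<close> on which the linearization is to be expanded at
  \<open>lam0\<close>; the linearization exists, and lies in the space, at every parameter of the closure.
\<close>

definition linearization_gevrey ::
  "(nat \<Rightarrow> complex) \<Rightarrow> real \<Rightarrow> real \<Rightarrow> complex set \<Rightarrow> complex \<Rightarrow> bool"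
where
  "linearization_gevrey f \<tau> r S lam0 \<longleftrightarrow>
     (\<forall>lam\<in>closure S. fps_in_Hinf (linearization f lam) r) \<and>
     gevrey_expansion (Hinf r) (Hinf_norm r) \<tau> (\<lambda>lam. eval_fps (linearization f lam)) S lam0"

end

theory Submission
  imports Defs
begin

text \<open>
  Write \<open>H\<^sub>\<lambda>(z) = \<Sum>h\<^sub>k(\<lambda>) z\<^sup>k\<close>. Every \<open>h\<^sub>k\<close> is a rational function of \<open>\<lambda>\<close> whose poles are roots of
  unity of order less than \<open>k\<close>. Two regions around \<open>\<lambda>\<^sub>0\<close> stay away from these poles in a quantitative
  way. Since \<open>\<alpha>\<^sub>0\<close> is diophantine, \<open>\<bar>\<lambda>\<^sub>0\<^sup>j - 1\<bar>\<close> is at least of order \<open>j\<close> to the power \<open>1 - \<tau>\<close>, and this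
  survives for all \<open>j < k\<close> on a disk around \<open>\<lambda>\<^sub>0\<close> of radius proportional to \<open>k\<close> to the power \<open>-\<tau>\<close>.
  In a tangent disk the distance of \<open>\<lambda>\<close> to the unit circle is at least a multiple of
  \<open>\<bar>\<lambda> - \<lambda>\<^sub>0\<bar>\<^sup>2\<close>, so that where the first estimate fails the divisor \<open>\<lambda>\<^sup>j - 1\<close> is still bounded below by a
  power of \<open>j\<close>.

  A polynomial lower bound on the divisors yields \<open>\<bar>h\<^sub>k\<bar> \<le> A\<^sup>k\<close> (\<open>norm_lin_coeff_le\<close>). This is the
  theorem of Siegel; the proof below follows Brjuno: \<open>h\<^sub>k\<close> is a sum over trees with \<open>k\<close> leaves of
  products of reciprocal divisors, one for each inner node, and the divisors smaller than a certain
  multiple of \<open>2\<close> to the power \<open>-m \<mu>\<close> are so far apart in index that a tree contains at most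
  \<open>2 k / 2\<^sup>m\<close> of them. Instead of counting on trees, an explicit function is exhibited that satisfies the recursive inequality of
  such a count (\<open>sparse_supersolution\<close>).

  Gevrey estimates follow from the Cauchy inequalities on the shrinking disks: the coefficient of
  order \<open>N\<close> of the Taylor expansion of \<open>h\<^sub>k\<close> at \<open>\<lambda>\<^sub>0\<close> is at most \<open>A\<^sup>k\<close> times the \<open>N\<close>-th power of a multiple
  of \<open>k\<close> to the power \<open>\<tau>\<close>, and the same holds for the remainder of order \<open>N\<close> divided by
  \<open>\<bar>\<lambda> - \<lambda>\<^sub>0\<bar>\<^sup>N\<close>, at all points where \<open>\<bar>h\<^sub>k\<bar> \<le> A\<^sup>k\<close> (\<open>taylor_remainder_le\<close>). After multiplication by
  \<open>z\<^sup>k\<close> with \<open>\<bar>z\<bar>\<close> small enough, the sum over \<open>k\<close> is controlled by \<open>\<Gamma>(1 + N \<tau>)\<close>, because \<open>k\<close> to the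
  power \<open>x\<close> is at most \<open>\<Gamma>(1 + x)\<close> times an exponential in \<open>k\<close> (\<open>powr_le_exp_Gamma\<close>).

  The radius depends only on the constants in the lower bound for the divisors. With the exponent
  \<open>\<mu> = 2 \<tau> + 1\<close>, one more than the tangent disks require, the size of the disks disappears from these
  constants in a neighbourhood of \<open>\<lambda>\<^sub>0\<close>: there only divisors of large index \<open>j\<close> fall under the second
  estimate, and the additional factor \<open>j\<close> absorbs the curvature of the disks.
\<close>

section \<open>Sums over compositions\<close>

lemma sum_inverse_squares_le:
  "(\<Sum>i=1..<n. 1 / (real i)\<^sup>2) \<le> 2"
proof -
  have "(\<Sum>i=1..<Suc n. 1 / (real i)\<^sup>2) \<le> 2 - 1 / real n" if "1 \<le> n" for n
    using that
  proof (induction n rule: dec_induct)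
    case base
    show ?case by simp
  next
    case (step n)
    have "1 / (real (Suc n))\<^sup>2 \<le> 1 / real n - 1 / real (Suc n)"
    proof -
      have "1 / (real (Suc n))\<^sup>2 \<le> 1 / (real n * real (Suc n))"
        using step.hyps by (intro divide_left_mono) (auto simp: power2_eq_square)
      also have "\<dots> = 1 / real n - 1 / real (Suc n)"
        using step.hyps by (simp add: divide_simps)
      finally show ?thesis .
    qed
    then show ?case
      using step.IH by simp
  qed
  from this[of "n - 1"] have "(\<Sum>i=1..<n. 1 / (real i)\<^sup>2) \<le> 2 - 1 / real (n - 1)" if "2 \<le> n"
    using that by simp
  also have "2 - 1 / real (n - 1) \<le> 2"
    by simp
  finally show ?thesis
    by (cases "2 \<le> n") auto
qed

text \<open>
  The sequence \<open>1 / k\<^sup>2\<close> is, up to a factor, closed under convolution. As a weight it absorbs the number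
  of compositions in the recursion for the linearization.
\<close>

lemma convolution_inverse_squares_le:
  "(\<Sum>i=1..<k. 1 / (real i)\<^sup>2 * (1 / (real (k - i))\<^sup>2)) \<le> 8 / (real k)\<^sup>2"
proof -
  have split: "1 / (real i)\<^sup>2 * (1 / (real (k - i))\<^sup>2)
      \<le> 2 / (real k)\<^sup>2 * (1 / (real i)\<^sup>2 + 1 / (real (k - i))\<^sup>2)" if "i \<in> {1..<k}" for i
  proof -
    define a b where "a = real i" and "b = real (k - i)"
    have pos: "a > 0" "b > 0" and k: "real k = a + b"
      using that by (auto simp: a_def b_def of_nat_diff)
    have sq: "(1 / a + 1 / b)\<^sup>2 \<le> 2 * ((1 / a)\<^sup>2 + (1 / b)\<^sup>2)"
      using sum_squares_bound[of "1 / a" "1 / b"] by (simp add: power2_sum)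
    have "1 / a + 1 / b = (a + b) / (a * b)"
      using pos by (simp add: field_simps)
    then have "1 / a\<^sup>2 * (1 / b\<^sup>2) = 1 / (a + b)\<^sup>2 * (1 / a + 1 / b)\<^sup>2"
      using pos by (simp add: power_divide power_mult_distrib)
    also have "\<dots> \<le> 1 / (a + b)\<^sup>2 * (2 * ((1 / a)\<^sup>2 + (1 / b)\<^sup>2))"
      using sq by (rule mult_left_mono) simp
    finally show ?thesis
      unfolding k a_def[symmetric] b_def[symmetric] by (simp add: power_divide)
  qed
  have "bij_betw (\<lambda>i. k - i) {1..<k} {1..<k}"
    by (rule bij_betwI[where g = "\<lambda>i. k - i"]) auto
  then have refl: "(\<Sum>i=1..<k. 1 / (real (k - i))\<^sup>2) = (\<Sum>i=1..<k. 1 / (real i)\<^sup>2)"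
    by (rule sum.reindex_bij_betw)
  have "(\<Sum>i=1..<k. 1 / (real i)\<^sup>2 * (1 / (real (k - i))\<^sup>2))
      \<le> (\<Sum>i=1..<k. 2 / (real k)\<^sup>2 * (1 / (real i)\<^sup>2 + 1 / (real (k - i))\<^sup>2))"
    by (intro sum_mono split)
  also have "\<dots> = 2 / (real k)\<^sup>2 * (2 * (\<Sum>i=1..<k. 1 / (real i)\<^sup>2))"
    by (simp only: sum_distrib_left[symmetric] sum.distrib refl mult_2)
  also have "\<dots> \<le> 2 / (real k)\<^sup>2 * (2 * 2)"
    by (intro mult_left_mono sum_inverse_squares_le) auto
  finally show ?thesis by simp
qed

lemma sum_compositions_Suc:
  fixes F :: "nat list \<Rightarrow> 'a::comm_monoid_add"
  assumes "1 \<le> j"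
  shows "sum F (compositions (Suc j) k)
    = (\<Sum>i=1..<k. \<Sum>e\<in>compositions j (k - i). F (i # e))"
proof -
  have "sum F (compositions (Suc j) k)
      = (\<Sum>(i, e)\<in>(SIGMA i:{1..<k}. compositions j (k - i)). F (i # e))"
  proof -
    have "bij_betw (\<lambda>(i, e). i # e) (SIGMA i:{1..<k}. compositions j (k - i))
        (compositions (Suc j) k)"
    proof (rule bij_betwI[where g = "\<lambda>e. (hd e, tl e)"])
      show "(\<lambda>e. (hd e, tl e)) \<in> compositions (Suc j) k \<rightarrow> (SIGMA i:{1..<k}. compositions j (k - i))"
      proof
        fix e assume e: "e \<in> compositions (Suc j) k"
        then obtain i e' where ie: "e = i # e'"
          by (auto simp: compositions_def length_Suc_conv)
        have "i < k"
          using compositions_less[OF e, of i] assms ie by simp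
        then show "(hd e, tl e) \<in> (SIGMA i:{1..<k}. compositions j (k - i))"
          using e ie by (auto simp: compositions_def)
      qed
    qed (auto simp: compositions_def length_Suc_conv)
    from sum.reindex_bij_betw[OF this, of F] show ?thesis
      by (simp add: case_prod_unfold)
  qed
  then show ?thesis
    by (simp add: sum.Sigma finite_compositions)
qed

lemma sum_compositions_inverse_squares_le:
  assumes "1 \<le> j"
  shows "(\<Sum>e\<in>compositions j k. prod_list (map (\<lambda>i. 1 / (real i)\<^sup>2) e))
    \<le> 8 ^ (j - 1) / (real k)\<^sup>2"
  using assms
proof (induction j arbitrary: k rule: dec_induct)
  case base
  have "compositions 1 k = (if k = 0 then {} else {[k]})"
    by (auto simp: compositions_def length_Suc_conv)
  then show ?case
    by simp
next
  case (step j)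
  have "(\<Sum>e\<in>compositions (Suc j) k. prod_list (map (\<lambda>i. 1 / (real i)\<^sup>2) e))
      = (\<Sum>i=1..<k. 1 / (real i)\<^sup>2
          * (\<Sum>e\<in>compositions j (k - i). prod_list (map (\<lambda>i. 1 / (real i)\<^sup>2) e)))"
    using step.hyps by (simp add: sum_compositions_Suc sum_distrib_left)
  also have "\<dots> \<le> (\<Sum>i=1..<k. 1 / (real i)\<^sup>2 * (8 ^ (j - 1) / (real (k - i))\<^sup>2))"
    by (intro sum_mono mult_left_mono step.IH) auto
  also have "\<dots> = 8 ^ (j - 1) * (\<Sum>i=1..<k. 1 / (real i)\<^sup>2 * (1 / (real (k - i))\<^sup>2))"
    by (simp add: sum_distrib_left field_simps)
  also have "\<dots> \<le> 8 ^ (j - 1) * (8 / (real k)\<^sup>2)"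
    by (intro mult_left_mono convolution_inverse_squares_le) auto
  also have "\<dots> = 8 ^ (Suc j - 1) / (real k)\<^sup>2"
    using step.hyps by (cases j) auto
  finally show ?case .
qed

section \<open>Counting sparse indices along a recursion\<close>

lemma composition_length_le:
  "(\<And>i. i \<in> set e \<Longrightarrow> 0 < i) \<Longrightarrow> length e \<le> sum_list (e :: nat list)"
  by (induction e) (force simp: Suc_le_eq)+

text \<open>
  Adding up nonnegative quantities bounded by \<open>u * i - 1\<close> loses \<open>1\<close> for each that is positive. So either
  at most one of them is positive, or at least \<open>2\<close> is lost; this trichotomy drives Brjuno's count.
\<close>

lemma sum_list_mono_excess:
  fixes g :: "nat \<Rightarrow> real"
  assumes "0 \<le> u" and "\<And>i. i \<in> set e \<Longrightarrow> 0 \<le> g i" and "\<And>i. i \<in> set e \<Longrightarrow> g i \<le> max 0 (u * real i - 1)"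
  shows "sum_list (map g e) = 0 \<or> (\<exists>i\<in>set e. sum_list (map g e) = g i)
    \<or> sum_list (map g e) \<le> u * real (sum_list e) - 2"
  using assms
proof (induction e)
  case (Cons a e)
  define s where "s = sum_list (map g e)"
  have IH: "s = 0 \<or> (\<exists>i\<in>set e. s = g i) \<or> s \<le> u * real (sum_list e) - 2"
    using Cons by (simp add: s_def)
  have a: "0 \<le> g a" "g a \<le> max 0 (u * real a - 1)" and ua: "0 \<le> u * real a"
    using Cons.prems by auto
  have distr: "u * real (sum_list (a # e)) = u * real a + u * real (sum_list e)"
    by (simp add: algebra_simps)
  show ?case
  proof (cases "g a = 0 \<or> s = 0")
    case True
    then show ?thesis
      using IH ua by (auto simp: algebra_simps s_def[symmetric])
  next
    case False
    then have ga: "g a \<le> u * real a - 1"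
      using a by auto
    have "s \<le> u * real (sum_list e) - 1"
      using IH
    proof (elim disjE bexE)
      fix i assume i: "i \<in> set e" "s = g i"
      then have "g i \<le> u * real i - 1"
        using Cons.prems(2,3)[of i] False by (auto simp: max_def split: if_splits)
      moreover have "u * real i \<le> u * real (sum_list e)"
        using i \<open>0 \<le> u\<close> by (intro mult_left_mono of_nat_mono member_le_sum_list) auto
      ultimately show ?thesis using i by simp
    qed (use False in auto)
    then show ?thesis
      using ga unfolding distr by (simp add: s_def[symmetric])
  qed
qed simp

text \<open>
  For \<open>w \<ge> 0\<close>, the maximum over all trees with \<open>k\<close> leaves of the sum of \<open>w\<close> over the inner nodes, where
  \<open>w\<close> is evaluated at the number of leaves below the node, satisfies this condition with equality for the
  best composition. Any supersolution dominates that maximum, and it is all that an estimate by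
  induction over the recursion of the linearization needs.
\<close>

definition supersolution :: "(nat \<Rightarrow> real) \<Rightarrow> (nat \<Rightarrow> real) \<Rightarrow> bool" where
  "supersolution w g \<longleftrightarrow> (\<forall>k. 0 \<le> g k) \<and>
     (\<forall>j k e. 2 \<le> j \<longrightarrow> e \<in> compositions j k \<longrightarrow> w k + sum_list (map g e) \<le> g k)"

lemma supersolution_add:
  "supersolution w g \<Longrightarrow> supersolution w' g' \<Longrightarrow> supersolution (\<lambda>k. w k + w' k) (\<lambda>k. g k + g' k)"
  unfolding supersolution_def by (fastforce simp: sum_list_addf)

lemma supersolution_scale:
  "supersolution w g \<Longrightarrow> 0 \<le> c \<Longrightarrow> supersolution (\<lambda>k. c * w k) (\<lambda>k. c * g k)"
  unfolding supersolution_def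
  by (auto simp: sum_list_const_mult distrib_left[symmetric] mult_left_mono)

lemma supersolution_sum:
  "(\<And>m. m \<in> A \<Longrightarrow> supersolution (w m) (g m)) \<Longrightarrow> supersolution (\<lambda>k. \<Sum>m\<in>A. w m k) (\<lambda>k. \<Sum>m\<in>A. g m k)"
proof (induction A rule: infinite_finite_induct)
  case (insert x F)
  then show ?case by (simp add: supersolution_add)
qed (simp_all add: supersolution_def)

text \<open>
  A tree with \<open>k\<close> leaves all of whose inner nodes branch has at most \<open>k - 1\<close> inner nodes.
\<close>

lemma supersolution_one: "supersolution (\<lambda>_. 1) (\<lambda>k. real (k - 1))"
  unfolding supersolution_def
proof (intro conjI allI impI)
  fix j k e assume e: "2 \<le> j" "e \<in> compositions j k"
  have "sum_list (map (\<lambda>k. real (k - 1)) e) = real (sum_list e) - real (length e)"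
    if "\<forall>i\<in>set e. 0 < i" for e :: "nat list"
    using that by (induction e) auto
  moreover have "length e \<le> sum_list e"
    using e by (intro composition_length_le) (auto simp: compositions_def)
  ultimately show "1 + sum_list (map (\<lambda>k. real (k - 1)) e) \<le> real (k - 1)"
    using e by (auto simp: compositions_def)
qed auto

text \<open>
  Brjuno's counting lemma. A tree with \<open>k\<close> leaves contains at most \<open>2 * k / q - 1\<close> bad nodes, if any. The
  bound alone is not a supersolution: a bad node over a single large subtree, only slightly smaller
  than itself, would violate it. But then this subtree lies below the bad index \<open>n\<close> of that node and the
  next smaller bad index is at least \<open>q\<close> away, so that the subtree satisfies the better bound
  \<open>2 * n / q - 2\<close>. The supersolution is the minimum of both bounds, with \<open>n\<close> the least bad index above
  \<open>k\<close>. It is cut off at \<open>0\<close> because trees with few leaves contain no bad node.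
\<close>

lemma sparse_supersolution:
  fixes bad :: "nat \<Rightarrow> bool" and q :: real
  assumes "0 < q" and large: "\<And>k. bad k \<Longrightarrow> q \<le> real k"
    and gap: "\<And>a b. bad a \<Longrightarrow> bad b \<Longrightarrow> a < b \<Longrightarrow> q \<le> real b - real a"
  obtains g where "supersolution (\<lambda>k. of_bool (bad k)) g" and "\<And>k. g k \<le> 2 * real k / q"
proof -
  define u where "u = 2 / q"
  have u: "0 < u" "u * q = 2"
    using assms(1) by (auto simp: u_def)
  define next_bad where "next_bad k = (LEAST n. k < n \<and> bad n)" for k
  \<comment> \<open>Without a bad index above \<open>k\<close> the value of \<open>next_bad k\<close> is arbitrary and must not be used.\<close>
  define g where "g k = max 0 (if \<exists>n>k. bad n
      then min (u * real k - 1) (u * real (next_bad k) - 2) else u * real k - 1)" for k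
  have nextb: "k < next_bad k" "bad (next_bad k)" if "\<exists>n>k. bad n" for k
    using LeastI_ex[OF that] by (auto simp: next_bad_def)
  have next_le: "next_bad k \<le> n" if "k < n" "bad n" for k n
    unfolding next_bad_def using that by (intro Least_le) auto
  have g0: "0 \<le> g k" for k by (simp add: g_def)
  have g1: "g k \<le> max 0 (u * real k - 1)" for k by (auto simp: g_def)
  have g2: "g k \<le> max 0 (u * real n - 2)" if "k < n" "bad n" for k n
  proof -
    have "u * real (next_bad k) \<le> u * real n"
      using next_le[OF that] u by (intro mult_left_mono) auto
    then show ?thesis using that by (auto simp: g_def)
  qed
  have "of_bool (bad k) + sum_list (map g e) \<le> g k" if j: "2 \<le> j" and e: "e \<in> compositions j k" for j k e
  proof -
    have se: "sum_list e = k" using e by (simp add: compositions_def)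
    have less: "i < k" if "i \<in> set e" for i
      using compositions_less[OF e j that] .
    consider (none) "sum_list (map g e) = 0"
      | (one) i where "i \<in> set e" "sum_list (map g e) = g i" "g i > 0"
      | (many) "sum_list (map g e) \<le> u * real k - 2"
      using sum_list_mono_excess[of u e g] g0 g1 u se by (metis less_eq_real_def)
    note cases = this
    have nk: "u * real k \<le> u * real (next_bad k)" if "\<exists>n>k. bad n"
      using nextb[OF that] u by simp
    show ?thesis
    proof (cases "bad k")
      case True
      have uk: "2 \<le> u * real k"
        using large[OF True] u by (metis mult_left_mono less_eq_real_def)
      have "u * real k \<le> u * real (next_bad k) - 2" if "\<exists>n>k. bad n"
      proof -
        have "u * q \<le> u * (real (next_bad k) - real k)"
          using gap[OF True nextb(2)[OF that] nextb(1)[OF that]] u by (intro mult_left_mono) auto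
        then show ?thesis using u by (simp add: algebra_simps)
      qed
      then have "u * real k - 1 \<le> g k"
        by (cases "\<exists>n>k. bad n") (simp_all only: g_def if_True if_False, auto)
      moreover have "1 + sum_list (map g e) \<le> u * real k - 1"
        using cases
      proof cases
        case one
        \<comment> \<open>The root is bad and only one subtree counts: the root is a bad index above \<open>i\<close>.\<close>
        have "g i \<le> u * real k - 2"
          using g2[OF less[OF one(1)] True] one uk by auto
        then show ?thesis using one by simp
      qed (use uk in auto)
      ultimately show ?thesis using True by simp
    next
      case False
      have "sum_list (map g e) \<le> g k"
        using cases
      proof cases
        case none
        then show ?thesis using g0 by simp
      next
        case one
        have ik: "i < k" using less one by auto
        have "g i \<le> u * real k - 1"
        proof -
          have "u * real i \<le> u * real k" using ik u by simp
          then show ?thesis using one(3) g1[of i] by auto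
        qed
        moreover have "g i \<le> u * real (next_bad k) - 2" if ex: "\<exists>n>k. bad n"
          using g2[of i "next_bad k"] nextb[OF ex] ik one(3) by auto
        ultimately show ?thesis using one by (auto simp: g_def)
      next
        case many
        then show ?thesis
          using nk by (cases "\<exists>n>k. bad n") (simp_all only: g_def if_True if_False, auto)
      qed
      then show ?thesis using False by simp
    qed
  qed
  then have "supersolution (\<lambda>k. of_bool (bad k)) g"
    unfolding supersolution_def using g0 by auto
  moreover have "g k \<le> 2 * real k / q" for k
  proof -
    have "0 \<le> u * real k" using u by simp
    then have "g k \<le> u * real k" using g1[of k] by simp
    then show ?thesis by (simp add: u_def)
  qed
  ultimately show ?thesis by (rule that)
qed

section \<open>Exponential bounds for the linearization\<close>

text \<open>
  Divisors are sorted by dyadic levels: at level \<open>m\<close> an index \<open>k\<close> is bad if \<open>lam ^ (k - 1) - 1\<close> is smaller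
  than \<open>1 / (4 * C * (2 ^ m) powr \<mu>)\<close>. If \<open>a < b\<close> are bad, then \<open>lam ^ (a - 1)\<close> and \<open>lam ^ (b - 1)\<close> are
  both close to \<open>1\<close>, hence so is their quotient \<open>lam ^ (b - a)\<close>, and the lower bound on the divisors forces \<open>b - a \<ge> 2 ^ m\<close>. So the level has
  a supersolution that is at most \<open>2 * k / 2 ^ m\<close>. The negative logarithm of a divisor is at most
  \<open>ln (4 * C)\<close> plus \<open>\<mu> * ln 2\<close> times the number of levels at which its index is bad, and summing the
  supersolutions of all levels gives a geometric series.
\<close>

lemma divisor_supersolution:
  fixes lam :: complex and C \<mu> :: real and n :: nat
  assumes "1 \<le> C" "0 \<le> \<mu>"
    and div: "\<And>j. 1 \<le> j \<Longrightarrow> j < n \<Longrightarrow> 1 \<le> C * real j powr \<mu> * norm (lam ^ j - 1)"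
  obtains g where "\<And>k. 0 \<le> g k" and "\<And>k. g k \<le> real k * (ln (4 * C) + 4 * \<mu> * ln 2)"
    and "\<And>j k e. 2 \<le> j \<Longrightarrow> k \<le> n \<Longrightarrow> e \<in> compositions j k \<Longrightarrow>
      exp (sum_list (map g e)) \<le> norm (lam ^ (k - 1) - 1) * exp (g k)"
proof -
  define small where "small m k \<longleftrightarrow> norm (lam ^ (k - 1) - 1) * (4 * C * (2 ^ m) powr \<mu>) < 1" for m k
  define bad where "bad m k \<longleftrightarrow> 2 \<le> k \<and> k \<le> n \<and> small m k" for m k
  have far: "2 ^ m \<le> real d" if d: "1 \<le> d" "d < n"
    and *: "norm (lam ^ d - 1) * (C * (2 ^ m) powr \<mu>) < 1" for m d
  proof (rule ccontr)
    assume "\<not> 2 ^ m \<le> real d"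
    then have "real d powr \<mu> \<le> (2 ^ m) powr \<mu>"
      using assms(2) by (intro powr_mono2) auto
    then have "C * real d powr \<mu> * norm (lam ^ d - 1) \<le> C * (2 ^ m) powr \<mu> * norm (lam ^ d - 1)"
      using assms(1) by (intro mult_right_mono mult_left_mono) auto
    then show False
      using div[OF d] * by (simp add: mult_ac)
  qed
  have "\<exists>g. supersolution (\<lambda>k. of_bool (bad m k)) g \<and> (\<forall>k. g k \<le> 2 * real k / 2 ^ m)" for m
  proof -
    define t where "t = C * (2 ^ m) powr \<mu>"
    have "1 * 1 \<le> C * (2 ^ m) powr \<mu>"
      using assms(1,2) by (intro mult_mono ge_one_powr_ge_zero) auto
    then have t: "1 \<le> t" by (simp add: t_def)
    have bad_less: "norm (lam ^ (k - 1) - 1) < 1 / (4 * t)" if "bad m k" for k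
      using that t by (auto simp: bad_def small_def t_def field_simps)
    have large: "2 ^ m \<le> real k" if "bad m k" for k
    proof -
      have "norm (lam ^ (k - 1) - 1) * t < 1"
        using bad_less[OF that] t by (simp add: field_simps)
      then have "2 ^ m \<le> real (k - 1)"
        using that by (intro far) (auto simp: bad_def t_def)
      then show ?thesis by simp
    qed
    have gap: "2 ^ m \<le> real b - real a" if ab: "bad m a" "bad m b" "a < b" for a b
    proof -
      define A where "A = lam ^ (a - 1)"
      define X where "X = lam ^ (b - a) - 1"
      have ge: "2 \<le> a" using ab by (simp add: bad_def)
      have "lam ^ (b - 1) = A * lam ^ (b - a)"
        using ab ge unfolding A_def power_add[symmetric] by (intro arg_cong[where f = "\<lambda>i. lam ^ i"]) simp
      then have "A * X = (lam ^ (b - 1) - 1) - (A - 1)"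
        by (simp add: X_def algebra_simps)
      then have "norm A * norm X \<le> norm (lam ^ (b - 1) - 1) + norm (A - 1)"
        using norm_triangle_ineq4[of "lam ^ (b - 1) - 1" "A - 1"] by (simp add: norm_mult[symmetric])
      also have "\<dots> < 1 / (4 * t) + 1 / (4 * t)"
        using bad_less[OF ab(1)] bad_less[OF ab(2)] by (simp add: A_def)
      finally have AX: "norm A * norm X < 1 / (2 * t)"
        by simp
      have "1 / (4 * t) \<le> 1 / 4" using t by (simp add: field_simps)
      then have "norm (A - 1) < 1 / 2"
        using bad_less[OF ab(1)] by (simp add: A_def)
      then have "1 / 2 \<le> norm A"
        using norm_triangle_ineq3[of A 1] by simp
      then have "1 / 2 * norm X \<le> norm A * norm X"
        by (intro mult_right_mono) auto
      with AX have "norm X < 1 / t" by simp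
      then have "norm X * t < 1" using t by (simp add: field_simps)
      then have "2 ^ m \<le> real (b - a)"
        using ab ge by (intro far) (auto simp: X_def t_def bad_def)
      then show ?thesis using ab by (simp add: of_nat_diff)
    qed
    show ?thesis
      by (rule sparse_supersolution[of "2 ^ m" "bad m"]) (use large gap in auto)
  qed
  then obtain g where super: "\<And>m. supersolution (\<lambda>k. of_bool (bad m k)) (g m)"
    and g_le: "\<And>m k. g m k \<le> 2 * real k / 2 ^ m"
    by metis
  \<comment> \<open>No index up to \<open>n\<close> is bad at level \<open>n\<close>, because \<open>n \<le> 2 ^ n\<close>; so the levels below \<open>n\<close> suffice.\<close>
  define G where "G k = ln (4 * C) * real (k - 1) + \<mu> * ln 2 * (\<Sum>m<n. g m k)" for k
  define w where "w k = ln (4 * C) * 1 + \<mu> * ln 2 * (\<Sum>m<n. of_bool (bad m k))" for k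
  have superG: "supersolution w G"
    unfolding w_def G_def
    by (intro supersolution_add supersolution_scale supersolution_sum supersolution_one super)
      (use assms in auto)
  have w_ge: "1 \<le> norm (lam ^ (k - 1) - 1) * exp (w k)" if k: "2 \<le> k" "k \<le> n" for k
  proof -
    define N where "N = norm (lam ^ (k - 1) - 1)"
    have N: "1 \<le> C * real (k - 1) powr \<mu> * N"
      using div[of "k - 1"] k by (simp add: N_def)
    then have Npos: "0 < N"
      by (smt (verit) N_def mult_eq_0_iff norm_ge_zero)
    have ex: "\<not> small n k"
    proof -
      have "real (k - 1) powr \<mu> \<le> (2 ^ n) powr \<mu>"
      proof (rule powr_mono2)
        have "real (k - 1) \<le> real n" using k by simp
        also have "\<dots> \<le> 2 ^ n" using of_nat_less_two_power[of n, where ?'a = real] by simp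
        finally show "real (k - 1) \<le> 2 ^ n" .
      qed (use assms(2) in auto)
      then have "C * real (k - 1) powr \<mu> * N \<le> C * (2 ^ n) powr \<mu> * N"
        using assms(1) Npos by (intro mult_right_mono mult_left_mono) auto
      also have "\<dots> \<le> N * (4 * C * (2 ^ n) powr \<mu>)"
        using assms(1) Npos by simp
      finally show ?thesis using N by (simp add: small_def N_def)
    qed
    \<comment> \<open>The index is bad at all levels below \<open>l\<close>; at level \<open>l\<close> the divisor is bounded from below.\<close>
    define l where "l = (LEAST m. \<not> small m k)"
    have l: "\<not> small l k" "l \<le> n"
      unfolding l_def using ex by (rule LeastI, rule Least_le)
    have below: "bad m k" if "m < l" for m
      using not_less_Least[of m "\<lambda>m. \<not> small m k"] that k by (auto simp: bad_def l_def)
    have "real l = (\<Sum>m<l. of_bool (bad m k))"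
      using below by simp
    also have "\<dots> \<le> (\<Sum>m<n. of_bool (bad m k))"
      using l by (intro sum_mono2) auto
    finally have "\<mu> * ln 2 * real l \<le> \<mu> * ln 2 * (\<Sum>m<n. of_bool (bad m k))"
      using assms(2) by (intro mult_left_mono) auto
    moreover have "(4 * C) * (2 ^ l) powr \<mu> = exp (ln (4 * C) + \<mu> * ln 2 * real l)"
      using assms(1) by (simp add: exp_add powr_def ln_realpow mult_ac)
    ultimately have "(4 * C) * (2 ^ l) powr \<mu> \<le> exp (w k)"
      by (simp add: w_def)
    then have "N * ((4 * C) * (2 ^ l) powr \<mu>) \<le> N * exp (w k)"
      using Npos by (intro mult_left_mono) auto
    then show ?thesis
      using l(1) by (simp add: small_def N_def)
  qed
  show ?thesis
  proof (rule that)
    show "0 \<le> G k" for k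
      using superG unfolding supersolution_def by blast
  next
    fix k
    have "(\<Sum>m<n. g m k) \<le> (\<Sum>m<n. 2 * real k * (1 / 2) ^ m)"
      using g_le by (intro sum_mono) (simp add: power_one_over)
    also have "\<dots> \<le> 2 * real k * 2"
      unfolding sum_distrib_left[symmetric]
      using geometric_sum[of "1 / 2 :: real" n] by (intro mult_left_mono) simp_all
    finally have "\<mu> * ln 2 * (\<Sum>m<n. g m k) \<le> \<mu> * ln 2 * (4 * real k)"
      using assms(2) by (intro mult_left_mono) auto
    moreover have "ln (4 * C) * real (k - 1) \<le> ln (4 * C) * real k"
      using assms(1) by (intro mult_left_mono) auto
    ultimately show "G k \<le> real k * (ln (4 * C) + 4 * \<mu> * ln 2)"
      by (simp add: G_def algebra_simps)
  next
    fix j k e assume e: "2 \<le> j" "k \<le> n" "e \<in> compositions j k"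
    have "2 \<le> k"
      using composition_length_le[of e] e by (auto simp: compositions_def)
    have "w k + sum_list (map G e) \<le> G k"
      using superG e unfolding supersolution_def by blast
    then have "exp (w k) * exp (sum_list (map G e)) \<le> exp (G k)"
      by (simp add: exp_add[symmetric])
    then have "norm (lam ^ (k - 1) - 1) * (exp (w k) * exp (sum_list (map G e)))
        \<le> norm (lam ^ (k - 1) - 1) * exp (G k)"
      by (intro mult_left_mono) auto
    moreover have "1 * exp (sum_list (map G e))
        \<le> norm (lam ^ (k - 1) - 1) * exp (w k) * exp (sum_list (map G e))"
      by (intro mult_right_mono w_ge \<open>2 \<le> k\<close> e) auto
    ultimately show "exp (sum_list (map G e)) \<le> norm (lam ^ (k - 1) - 1) * exp (G k)"
      by (simp only: mult.assoc mult_1_left)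
  qed
qed

text \<open>
  Siegel's estimate, by induction on \<open>k\<close> for the sharper bound \<open>s k * exp (g k)\<close>. The supersolution \<open>g\<close>
  takes care of the small divisors, and \<open>s k = D ^ (k - 1) / k\<^sup>2\<close> is a majorant for the recursion without
  them: \<open>D\<close> is chosen such that the terms with \<open>j\<close> factors contribute at most \<open>s k / 2 ^ (j - 1)\<close>.
  Only the divisors with index less than \<open>n\<close> enter, which matters on the disks around \<open>\<lambda>\<^sub>0\<close> that shrink
  with \<open>k\<close>.
\<close>

lemma norm_lin_coeff_le:
  fixes f :: "nat \<Rightarrow> complex" and lam :: complex and B C \<mu> :: real
  assumes "1 \<le> B" and f: "\<And>j. 2 \<le> j \<Longrightarrow> norm (f j) \<le> B ^ (j - 1)"
    and "1 \<le> C" "0 \<le> \<mu>"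
    and div: "\<And>j. 1 \<le> j \<Longrightarrow> j < n \<Longrightarrow> 1 \<le> C * real j powr \<mu> * norm (lam ^ j - 1)"
    and "k \<le> n"
  shows "norm (lin_coeff f lam k) \<le> (64 * B * C * 16 powr \<mu>) ^ k"
proof -
  obtain g where g0: "\<And>k. 0 \<le> g k" and g_le: "\<And>k. g k \<le> real k * (ln (4 * C) + 4 * \<mu> * ln 2)"
    and g: "\<And>j k e. 2 \<le> j \<Longrightarrow> k \<le> n \<Longrightarrow> e \<in> compositions j k \<Longrightarrow>
      exp (sum_list (map g e)) \<le> norm (lam ^ (k - 1) - 1) * exp (g k)"
    using divisor_supersolution[OF assms(3,4) div] by metis
  define D where "D = 16 * B"
  have D: "16 \<le> D" using assms(1) by (simp add: D_def)
  define s where "s k = D ^ (k - 1) * (1 / (real k)\<^sup>2)" for k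
  have s0: "0 \<le> s k" for k using D by (simp add: s_def)
  have prod_s: "prod_list (map s e) = D ^ (k - j) * prod_list (map (\<lambda>i. 1 / (real i)\<^sup>2) e)"
    if "e \<in> compositions j k" for j k e
  proof -
    have "prod_list (map s e) = D ^ (sum_list e - length e) * prod_list (map (\<lambda>i. 1 / (real i)\<^sup>2) e)"
      if "\<forall>i\<in>set e. 0 < i" for e
      using that
    proof (induction e)
      case (Cons a e)
      have "length e \<le> sum_list e"
        using Cons.prems by (intro composition_length_le) auto
      then have "D ^ (sum_list (a # e) - length (a # e)) = D ^ (a - 1) * D ^ (sum_list e - length e)"
        using Cons.prems by (simp add: power_add[symmetric])
      then show ?case using Cons by (simp add: s_def)
    qed simp
    then show ?thesis using that by (auto simp: compositions_def)
  qed
  have main: "norm (lin_coeff f lam k) \<le> s k * exp (g k)" if "1 \<le> k" "k \<le> n" for k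
    using that
  proof (induction k rule: less_induct)
    case (less k)
    show ?case
    proof (cases "k = 1")
      case True
      show ?thesis
        using True g0 by (simp add: s_def lin_coeff.simps)
    next
      case False
      with less.prems have k: "2 \<le> k" by simp
      define N where "N = norm (lam ^ (k - 1) - 1)"
      have Npos: "0 < N"
      proof -
        have "1 \<le> C * real (k - 1) powr \<mu> * N"
          unfolding N_def using k less.prems by (intro div) auto
        then have "N \<noteq> 0" by auto
        then show ?thesis by (simp add: N_def)
      qed
      have term_le: "norm (prod_list (map (lin_coeff f lam) e)) \<le> prod_list (map s e) * (N * exp (g k))"
        if j: "2 \<le> j" and e: "e \<in> compositions j k" for j e
      proof -
        have "norm (prod_list (map h e)) \<le> prod_list (map s e) * exp (sum_list (map g e))"
          if "\<forall>i\<in>set e. norm (h i) \<le> s i * exp (g i)" for h :: "nat \<Rightarrow> complex" and e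
          using that
        proof (induction e)
          case (Cons a e)
          have "norm (prod_list (map h (a # e)))
              \<le> (s a * exp (g a)) * (prod_list (map s e) * exp (sum_list (map g e)))"
            using Cons s0 by (auto simp: norm_mult intro!: mult_mono)
          then show ?case by (simp add: exp_add mult_ac)
        qed simp
        moreover have "norm (lin_coeff f lam i) \<le> s i * exp (g i)" if "i \<in> set e" for i
          using less.IH[OF compositions_less[OF e j that]] compositions_less[OF e j that] that e less.prems
          by (auto simp: compositions_def)
        ultimately have "norm (prod_list (map (lin_coeff f lam) e))
            \<le> prod_list (map s e) * exp (sum_list (map g e))" by blast
        also have "\<dots> \<le> prod_list (map s e) * (N * exp (g k))"
          using g[OF j less.prems(2) e] s0 by (intro mult_left_mono) (auto simp: N_def intro!: prod_list_nonneg)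
        finally show ?thesis .
      qed
      have "norm (lin_coeff f lam k) = 1 / N * norm (\<Sum>j=2..k. f j *
          (\<Sum>e\<in>compositions j k. prod_list (map (lin_coeff f lam) e)))"
        using k by (subst lin_coeff.simps) (auto simp: norm_mult norm_divide N_def)
      also have "\<dots> \<le> 1 / N * (\<Sum>j=2..k. B ^ (j - 1) *
          (\<Sum>e\<in>compositions j k. prod_list (map s e) * (N * exp (g k))))"
        using Npos assms(1)
        by (intro mult_left_mono sum_norm_le)
          (auto simp: norm_mult simp del: One_nat_def intro!: mult_mono f sum_norm_le term_le)
      also have "\<dots> = exp (g k) * (\<Sum>j=2..k. B ^ (j - 1) * D ^ (k - j) *
          (\<Sum>e\<in>compositions j k. prod_list (map (\<lambda>i. 1 / (real i)\<^sup>2) e)))"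
        using Npos by (simp add: sum_distrib_left prod_s mult_ac cong: sum.cong)
      also have "\<dots> \<le> exp (g k) * (\<Sum>j=2..k. B ^ (j - 1) * D ^ (k - j) * (8 ^ (j - 1) / (real k)\<^sup>2))"
        using assms(1) D by (intro mult_left_mono sum_mono sum_compositions_inverse_squares_le) auto
      also have "(\<Sum>j=2..k. B ^ (j - 1) * D ^ (k - j) * (8 ^ (j - 1) / (real k)\<^sup>2))
          = (\<Sum>j=2..k. s k * (1 / 2) ^ (j - 1))"
      proof (rule sum.cong)
        fix j assume j: "j \<in> {2..k}"
        have "D ^ (k - 1) = D ^ (k - j) * D ^ (j - 1)"
          using j by (simp add: power_add[symmetric])
        moreover have "D = 2 * (B * 8)"
          by (simp add: D_def)
        then have "D ^ (j - 1) = 2 ^ (j - 1) * (B ^ (j - 1) * 8 ^ (j - 1))"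
          by (simp only: power_mult_distrib)
        ultimately show "B ^ (j - 1) * D ^ (k - j) * (8 ^ (j - 1) / (real k)\<^sup>2) = s k * (1 / 2) ^ (j - 1)"
          by (simp add: s_def power_one_over field_simps)
      qed simp
      also have "\<dots> = s k * (\<Sum>j=2..k. (1 / 2) ^ (j - 1))"
        by (simp add: sum_distrib_left)
      also have "(\<Sum>j=2..k. (1 / 2) ^ (j - 1)) = 1 - (1 / 2 :: real) ^ (k - 1)"
        using k
      proof (induction k rule: dec_induct)
        case (step n)
        then show ?case by (cases n) auto
      qed simp
      also have "exp (g k) * (s k * (1 - (1 / 2) ^ (k - 1))) \<le> exp (g k) * (s k * 1)"
        using s0 by (intro mult_left_mono) auto
      finally show ?thesis by (simp add: mult_ac)
    qed
  qed
  show ?thesis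
  proof (cases "k = 0")
    case True
    then show ?thesis by (simp add: lin_coeff.simps)
  next
    case False
    have "s k \<le> D ^ (k - 1) * 1"
      unfolding s_def using D False by (intro mult_left_mono) (auto simp: field_simps)
    also have "\<dots> \<le> D ^ k"
      using D by (intro order_trans[OF _ power_increasing[of "k - 1" k D]]) auto
    finally have sk: "s k \<le> D ^ k" .
    have "exp (g k) \<le> exp (real k * (ln (4 * C) + 4 * \<mu> * ln 2))"
      using g_le by simp
    also have "\<dots> = (4 * C * 16 powr \<mu>) ^ k"
    proof -
      have "ln 16 = 4 * ln (2::real)"
        using ln_realpow[of 2 4] by simp
      then show ?thesis
        using assms(3) by (simp add: exp_of_nat_mult exp_add powr_def mult_ac)
    qed
    finally have "s k * exp (g k) \<le> D ^ k * (4 * C * 16 powr \<mu>) ^ k"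
      using sk s0 D by (intro mult_mono) auto
    also have "\<dots> = (D * (4 * C * 16 powr \<mu>)) ^ k"
      by (rule power_mult_distrib[symmetric])
    also have "D * (4 * C * 16 powr \<mu>) = 64 * B * C * 16 powr \<mu>"
      by (simp add: D_def)
    finally show ?thesis
      using main[of k] False assms(6) by simp
  qed
qed

lemma geometric_bound_of_conv_radius:
  fixes F :: "complex fps"
  assumes "1 \<le> fps_conv_radius F"
  obtains B where "1 \<le> B" and "\<And>k. 2 \<le> k \<Longrightarrow> norm (fps_nth F k) \<le> B ^ (k - 1)"
proof -
  have "ereal (norm (1 / 2 :: complex)) < 1" by simp
  also have "\<dots> \<le> fps_conv_radius F" by (rule assms)
  finally have "summable (\<lambda>k. norm (fps_nth F k * (1 / 2) ^ k))"
    by (rule norm_summable_fps)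
  then have "Bseq (\<lambda>k. norm (fps_nth F k * (1 / 2) ^ k))"
    by (intro convergent_imp_Bseq) (auto simp: convergent_def dest: summable_LIMSEQ_zero)
  then obtain K where K: "norm (fps_nth F k * (1 / 2) ^ k) \<le> K" for k
    by (auto simp: Bseq_def)
  define M where "M = max 1 K"
  have M: "1 \<le> M" by (simp add: M_def)
  show ?thesis
  proof (rule that)
    show "1 \<le> 4 * M" using M by simp
    fix k :: nat assume k: "2 \<le> k"
    have "norm (fps_nth F k) \<le> K * 2 ^ k"
      using K[of k] by (simp add: norm_mult norm_power norm_divide field_simps)
    also have "\<dots> \<le> M * 2 ^ k"
      by (simp add: M_def)
    also have "\<dots> \<le> M ^ (k - 1) * 2 ^ (2 * (k - 1))"
      using M k by (intro mult_mono power_increasing self_le_power) auto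
    also have "\<dots> = (4 * M) ^ (k - 1)"
      by (simp add: power_mult power_mult_distrib mult.commute)
    finally show "norm (fps_nth F k) \<le> (4 * M) ^ (k - 1)" .
  qed
qed

lemma lin_coeff_holomorphic:
  assumes "\<And>lam j. lam \<in> A \<Longrightarrow> 1 \<le> j \<Longrightarrow> j < k \<Longrightarrow> lam ^ j \<noteq> 1"
  shows "(\<lambda>lam. lin_coeff f lam k) holomorphic_on A"
  using assms
proof (induction k rule: less_induct)
  case (less k)
  have prod_hol: "(\<lambda>lam. prod_list (map (lin_coeff f lam) e)) holomorphic_on A"
    if "\<forall>i\<in>set e. i < k" for e
    using that
  proof (induction e)
    case (Cons i e)
    then show ?case
      using less.IH[of i] less.prems by (auto intro!: holomorphic_on_mult)
  qed simp
  show ?case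
  proof (cases "k \<le> 1")
    case True
    then show ?thesis by (cases "k = 0") (simp_all add: lin_coeff.simps)
  next
    case False
    have "(\<lambda>lam. 1 / (lam ^ (k - 1) - 1) *
        (\<Sum>j=2..k. f j * (\<Sum>e\<in>compositions j k. prod_list (map (lin_coeff f lam) e)))) holomorphic_on A"
      using False less.prems
      by (intro holomorphic_intros prod_hol) (auto dest: compositions_less)
    then show ?thesis
      using False by (subst lin_coeff.simps) simp
  qed
qed

section \<open>Lower bounds for the divisors\<close>

text \<open>
  For real \<open>x\<close> the chord between \<open>1\<close> and \<open>exp (2 \<pi> \<i> x)\<close> is \<open>2 * \<bar>sin (\<pi> * x)\<bar>\<close>; any linear lower bound for the sine on
  \<open>[0, \<pi> / 2]\<close> suffices.
\<close>

lemma norm_exp_minus_one_ge: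
  fixes x :: real
  assumes "\<bar>x\<bar> \<le> 1 / 2"
  shows "\<bar>x\<bar> \<le> norm (exp (2 * of_real pi * \<i> * of_real x) - 1)"
proof -
  define t where "t = pi * \<bar>x\<bar>"
  have t: "0 \<le> t" "t \<le> pi / 2"
    using assms mult_left_mono[OF assms, of pi] by (auto simp: t_def)
  have "t / 4 \<le> sin t"
  proof (cases "t \<le> pi / 3")
    case True
    show ?thesis
    proof (cases "t = 0")
      case False
      then obtain z where z: "0 < z" "z < t" "sin t - sin 0 = (t - 0) * cos z"
        using t MVT2[of 0 t sin cos] by (auto intro: DERIV_sin)
      have "cos (pi / 3) \<le> cos z"
        using z True by (intro cos_monotone_0_pi_le) auto
      then have "t * (1 / 2) \<le> t * cos z"
        using t by (intro mult_left_mono) (auto simp: cos_60)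
      then show ?thesis using z t by simp
    qed simp
  next
    case False
    have "sin (pi / 3) \<le> sin t"
      using False t by (intro sin_monotone_2pi_le) auto
    moreover have "1 \<le> sqrt 3" by simp
    ultimately have "1 / 2 \<le> sin t" unfolding sin_60 by linarith
    then show ?thesis using t pi_less_4 by simp
  qed
  moreover have "\<bar>sin (pi * x)\<bar> = \<bar>sin t\<bar>"
    by (simp add: t_def abs_if)
  moreover have "norm (exp (2 * of_real pi * \<i> * of_real x) - 1) = 2 * \<bar>sin (pi * x)\<bar>"
    using dist_exp_i_1[of "2 * pi * x"] by (simp add: mult_ac)
  moreover have "2 * \<bar>x\<bar> \<le> t"
    unfolding t_def using pi_ge_two by (intro mult_right_mono) auto
  ultimately show ?thesis by linarith
qed

lemma diophantine_divisors:
  assumes "diophantine \<tau> \<alpha>"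
  obtains c where "0 < c"
    and "\<And>j. 1 \<le> j \<Longrightarrow> c * real j powr (1 - \<tau>) \<le> norm (exp (2 * of_real pi * \<i> * of_real \<alpha>) ^ j - 1)"
proof -
  from assms obtain c where c: "0 < c"
    and dio: "\<And>(p::int) q::nat. 1 \<le> q \<Longrightarrow> c * real q powr (- \<tau>) \<le> \<bar>\<alpha> - real_of_int p / real q\<bar>"
    by (auto simp: diophantine_def)
  have "c * real j powr (1 - \<tau>) \<le> norm (exp (2 * of_real pi * \<i> * of_real \<alpha>) ^ j - 1)" if j: "1 \<le> j" for j
  proof -
    define p where "p = round (real j * \<alpha>)"
    define x where "x = real j * \<alpha> - of_int p"
    have "c * real j powr (1 - \<tau>) = real j * (c * real j powr (- \<tau>))"
      using j by (simp add: powr_diff powr_minus field_simps)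
    also have "\<dots> \<le> real j * \<bar>\<alpha> - of_int p / real j\<bar>"
      using dio[OF j, of p] by (intro mult_left_mono) auto
    also have "\<dots> = \<bar>x\<bar>"
      unfolding x_def using j by (subst abs_of_nat[symmetric], subst abs_mult[symmetric]) (simp add: right_diff_distrib)
    also have "\<dots> \<le> norm (exp (2 * of_real pi * \<i> * of_real x) - 1)"
      using of_int_round_abs_le[of "real j * \<alpha>"] unfolding x_def p_def
      by (intro norm_exp_minus_one_ge) linarith
    also have "exp (2 * of_real pi * \<i> * of_real x) = exp (2 * of_real pi * \<i> * of_real \<alpha>) ^ j"
    proof -
      have "exp (2 * of_real pi * \<i> * of_real \<alpha>) ^ j = exp (of_nat j * (2 * of_real pi * \<i> * of_real \<alpha>))"
        by (rule exp_of_nat_mult[symmetric])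
      also have "of_nat j * (2 * of_real pi * \<i> * of_real \<alpha>)
          = 2 * of_real pi * \<i> * of_real x + of_int (2 * p) * (of_real pi * \<i>)"
        by (simp add: x_def algebra_simps)
      also have "exp \<dots> = exp (2 * of_real pi * \<i> * of_real x) * exp (of_int (2 * p) * (of_real pi * \<i>))"
        by (rule exp_add)
      also have "exp (of_int (2 * p) * (of_real pi * \<i>)) = 1"
        using exp_integer_2pi[of "of_int p"] by (simp add: mult_ac)
      finally show ?thesis by simp
    qed
    finally show ?thesis .
  qed
  with c show ?thesis by (rule that)
qed

text \<open>
  Within distance \<open>1 / j\<close> of the unit circle, powers up to \<open>j\<close> are bounded by \<open>(1 + 1 / j) ^ j \<le> exp 1 \<le> 3\<close>, so
  that the \<open>j\<close>-th power has Lipschitz constant \<open>3 * j\<close>.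
\<close>

lemma norm_power_diff_near_unit_circle_le:
  fixes lam lam0 :: complex
  assumes "norm lam0 = 1" "1 \<le> j" "norm (lam - lam0) \<le> 1 / real j"
  shows "norm (lam ^ j - lam0 ^ j) \<le> 3 * real j * norm (lam - lam0)"
proof -
  have n: "norm lam \<le> 1 + 1 / real j"
    using norm_triangle_ineq2[of lam lam0] assms by simp
  have "(1 + 1 / real j) ^ j \<le> exp 1"
    using exp_ge_one_plus_x_over_n_power_n[of j 1] assms by simp
  then have e: "(1 + 1 / real j) ^ j \<le> 3"
    using exp_le by simp
  have "lam ^ j - lam0 ^ j = (lam - lam0) * (\<Sum>i<j. lam0 ^ (j - Suc i) * lam ^ i)"
    by (rule power_diff_sumr2)
  also have "norm \<dots> \<le> norm (lam - lam0) * (\<Sum>i<j. 3)"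
    unfolding norm_mult
  proof (intro mult_left_mono sum_norm_le)
    fix i assume "i \<in> {..<j}"
    then have "norm lam ^ i \<le> (1 + 1 / real j) ^ j"
      using n by (intro order_trans[OF power_mono[OF n] power_increasing]) auto
    then show "norm (lam0 ^ (j - Suc i) * lam ^ i) \<le> 3"
      using e by (simp add: norm_mult norm_power assms(1))
  qed auto
  finally show ?thesis by (simp add: mult_ac)
qed

text \<open>
  The divisor changes by at most \<open>3 * j * \<bar>lam - lam0\<bar>\<close>. On a disk of radius \<open>d * j powr (- \<tau>)\<close> this
  is of the same order as the diophantine lower bound at \<open>lam0\<close>, and at most half of it if \<open>6 * d \<le> c\<close>.
\<close>

lemma divisors_near_diophantine:
  fixes lam lam0 :: complex
  assumes lam0: "norm lam0 = 1" "c * real j powr (1 - \<tau>) \<le> norm (lam0 ^ j - 1)"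
    and "1 \<le> \<tau>" "1 \<le> j" "0 \<le> d" "d \<le> 1" "6 * d \<le> c"
    and near: "norm (lam - lam0) \<le> d * real j powr (- \<tau>)"
  shows "c / 2 * real j powr (1 - \<tau>) \<le> norm (lam ^ j - 1)"
proof -
  have powr_j: "real j * real j powr (- \<tau>) = real j powr (1 - \<tau>)"
    using assms by (simp add: powr_diff powr_minus field_simps)
  have "d * real j powr (- \<tau>) \<le> 1 * real j powr (- 1)"
    using assms by (intro mult_mono powr_mono) auto
  then have "norm (lam - lam0) \<le> 1 / real j"
    using near assms by (simp add: powr_minus divide_inverse)
  then have "norm (lam ^ j - lam0 ^ j) \<le> 3 * real j * norm (lam - lam0)"
    using assms by (intro norm_power_diff_near_unit_circle_le) auto
  also have "\<dots> \<le> 3 * real j * (d * real j powr (- \<tau>))"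
    using near by (intro mult_left_mono) auto
  also have "\<dots> = 3 * d * real j powr (1 - \<tau>)"
    using powr_j by (simp add: mult_ac)
  also have "\<dots> \<le> c / 2 * real j powr (1 - \<tau>)"
    using assms by (intro mult_right_mono) auto
  finally show ?thesis
    using lam0(2) norm_triangle_ineq[of "lam ^ j - 1" "lam0 ^ j - lam ^ j"]
    by (simp add: norm_minus_commute)
qed

lemma norm_power_minus_one_ge:
  fixes lam :: complex
  assumes "1 \<le> j"
  shows "\<bar>norm lam - 1\<bar> \<le> norm (lam ^ j - 1)"
proof -
  have "\<bar>norm lam - 1\<bar> \<le> \<bar>norm lam ^ j - 1\<bar>"
  proof (cases "1 \<le> norm lam")
    case True
    then have "norm lam ^ 1 \<le> norm lam ^ j"
      using assms by (intro power_increasing) auto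
    then show ?thesis using True by simp
  next
    case False
    then have "norm lam ^ j \<le> norm lam ^ 1"
      using assms by (intro power_decreasing) auto
    then show ?thesis using False by simp
  qed
  also have "\<dots> \<le> norm (lam ^ j - 1)"
    using norm_triangle_ineq3[of "lam ^ j" 1] by (simp add: norm_power)
  finally show ?thesis .
qed

text \<open>
  The centre of the disk is \<open>a * lam0\<close>, with \<open>a = 1 - r\<close> for the inner and \<open>a = 1 + r\<close> for the outer
  disk. The defining inequality of the disk and the expansion of \<open>\<bar>lam - lam0\<bar>\<^sup>2\<close> both depend on \<open>lam\<close>
  through \<open>\<bar>lam\<bar>\<^sup>2\<close> and the inner product with \<open>lam0\<close> only; eliminating the latter compares
  \<open>\<bar>lam - lam0\<bar>\<^sup>2\<close> with \<open>1 - \<bar>lam\<bar>\<^sup>2\<close>.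
\<close>

lemma tangent_disk_quadratic:
  fixes c lam lam0 :: complex and a r :: real
  assumes lam0: "norm lam0 = 1" and r: "0 < r" and a: "0 < a" "\<bar>1 - a\<bar> = r"
    and c: "norm c = a" "norm (lam0 - c) = r" and lam: "norm (lam - c) \<le> r"
  shows "a / (r * (a + r + 1)) * (norm (lam - lam0))\<^sup>2 \<le> \<bar>norm lam - 1\<bar>"
proof -
  have r2: "r\<^sup>2 = (1 - a)\<^sup>2" using a by (metis power2_abs)
  have expand: "(norm (x - b *\<^sub>R y))\<^sup>2 = (norm x)\<^sup>2 - 2 * b * (x \<bullet> y) + b\<^sup>2 * (norm y)\<^sup>2"
    for x y :: complex and b :: real
    unfolding power2_norm_eq_inner
    by (simp add: inner_diff_left inner_diff_right inner_commute algebra_simps power2_eq_square)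
  have "(norm (lam0 - c))\<^sup>2 = (norm lam0)\<^sup>2 - 2 * (lam0 \<bullet> c) + (norm c)\<^sup>2"
    using expand[of lam0 1 c] by simp
  then have lc: "lam0 \<bullet> c = a"
    using r2 by (simp add: c lam0 power2_eq_square algebra_simps)
  have "(norm (c - a *\<^sub>R lam0))\<^sup>2 = (norm c)\<^sup>2 - 2 * a * (lam0 \<bullet> c) + a\<^sup>2 * (norm lam0)\<^sup>2"
    using expand[of c a lam0] by (simp add: inner_commute)
  also have "\<dots> = 0"
    by (simp add: lc c lam0 power2_eq_square)
  finally have ceq: "c = a *\<^sub>R lam0" by simp
  define p where "p = lam \<bullet> lam0"
  define s where "s = 1 - (norm lam)\<^sup>2"
  have Q: "(norm (lam - lam0))\<^sup>2 = 2 * (1 - p) - s"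
  proof -
    have "(norm (lam - lam0))\<^sup>2 = (norm lam)\<^sup>2 - 2 * p + (norm lam0)\<^sup>2"
      using expand[of lam 1 lam0] by (simp add: p_def)
    then show ?thesis by (simp add: s_def lam0)
  qed
  have "(norm (lam - c))\<^sup>2 = (norm lam)\<^sup>2 - 2 * a * p + a\<^sup>2 * (norm lam0)\<^sup>2"
    unfolding ceq p_def by (rule expand)
  moreover have "(norm (lam - c))\<^sup>2 \<le> r\<^sup>2"
    using lam by (intro power_mono) auto
  ultimately have "(norm lam)\<^sup>2 - 2 * a * p + a\<^sup>2 \<le> (1 - a)\<^sup>2"
    by (simp add: lam0 r2)
  then have "a * (2 * (1 - p)) \<le> s"
    by (simp add: s_def power2_eq_square algebra_simps)
  then have "a * (norm (lam - lam0))\<^sup>2 \<le> s * (1 - a)"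
    unfolding Q by (simp add: algebra_simps)
  also have "\<dots> \<le> \<bar>s\<bar> * r"
    using a abs_ge_self[of "s * (1 - a)"] by (simp add: abs_mult)
  also have "\<bar>s\<bar> = \<bar>norm lam - 1\<bar> * (norm lam + 1)"
  proof -
    have "s = - ((norm lam - 1) * (norm lam + 1))"
      by (simp add: s_def power2_eq_square algebra_simps)
    then show ?thesis by (simp add: abs_mult)
  qed
  also have "\<bar>norm lam - 1\<bar> * (norm lam + 1) * r \<le> \<bar>norm lam - 1\<bar> * (a + r + 1) * r"
    using norm_triangle_ineq2[of lam c] lam c r by (intro mult_right_mono mult_left_mono) auto
  finally have "a * (norm (lam - lam0))\<^sup>2 \<le> \<bar>norm lam - 1\<bar> * (r * (a + r + 1))"
    by (simp only: mult_ac)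
  moreover have "0 < r * (a + r + 1)"
    using a r by simp
  ultimately show ?thesis
    by (simp add: pos_divide_le_eq)
qed

lemma inner_tangent_disk_quadratic:
  assumes "inner_tangent_disk lam0 D"
  obtains \<kappa> where "0 < \<kappa>" and "\<And>lam. lam \<in> closure D \<Longrightarrow> \<kappa> * (norm (lam - lam0))\<^sup>2 \<le> \<bar>norm lam - 1\<bar>"
proof -
  from assms obtain c r where r: "0 < r" and D: "D = ball c r" "D \<subseteq> ball 0 1"
    and sph: "sphere c r \<inter> sphere 0 1 = {lam0}"
    by (auto simp: inner_tangent_disk_def)
  from sph have lam0: "norm lam0 = 1" "norm (lam0 - c) = r"
    by (auto simp: dist_norm norm_minus_commute set_eq_iff)
  have le: "norm c + r \<le> 1"
    using D r ball_subset_ball_iff[of c r 0 1] by (auto simp: dist_norm)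
  have c: "norm c = 1 - r"
    using le lam0 norm_triangle_ineq2[of lam0 c] by simp
  have "c \<noteq> 0"
  proof
    assume "c = 0"
    then have "- lam0 \<in> sphere c r \<inter> sphere 0 1"
      using lam0 by auto
    then show False using sph lam0 by auto
  qed
  then have "0 < 1 - r" using c by (metis zero_less_norm_iff)
  show ?thesis
  proof (rule that)
    show "0 < (1 - r) / (r * (1 - r + r + 1))"
      using r \<open>0 < 1 - r\<close> by simp
    show "(1 - r) / (r * (1 - r + r + 1)) * (norm (lam - lam0))\<^sup>2 \<le> \<bar>norm lam - 1\<bar>" if "lam \<in> closure D" for lam
      using that r \<open>0 < 1 - r\<close> lam0 c D
      by (intro tangent_disk_quadratic) (auto simp: dist_norm norm_minus_commute)
  qed
qed

lemma outer_tangent_disk_quadratic: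
  assumes "outer_tangent_disk lam0 D"
  obtains \<kappa> where "0 < \<kappa>" and "\<And>lam. lam \<in> closure D \<Longrightarrow> \<kappa> * (norm (lam - lam0))\<^sup>2 \<le> \<bar>norm lam - 1\<bar>"
proof -
  from assms obtain c r where r: "0 < r" and D: "D = ball c r" "D \<subseteq> - ball 0 1"
    and sph: "sphere c r \<inter> sphere 0 1 = {lam0}"
    by (auto simp: outer_tangent_disk_def)
  from sph have lam0: "norm lam0 = 1" "norm (lam0 - c) = r"
    by (auto simp: dist_norm norm_minus_commute set_eq_iff)
  have "1 + r \<le> norm c"
  proof (rule ccontr)
    assume less: "\<not> 1 + r \<le> norm c"
    \<comment> \<open>The point that divides the segment from \<open>0\<close> to \<open>c\<close> in the ratio of the radii lies in both disks.\<close>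
    define p where "p = (1 / (1 + r)) *\<^sub>R c"
    have "norm p < 1"
      using less r by (simp add: p_def field_simps)
    moreover have "norm (c - p) < r"
    proof -
      have "c - p = (1 - 1 / (1 + r)) *\<^sub>R c"
        by (simp add: p_def scaleR_left_diff_distrib)
      also have "1 - 1 / (1 + r) = r / (1 + r)"
        using r by (simp add: field_simps)
      finally have "norm (c - p) = r * norm c / (1 + r)"
        using r by simp
      then show ?thesis
        using less r by (simp add: pos_divide_less_eq)
    qed
    ultimately show False
      using D by (auto simp: dist_norm)
  qed
  then have c: "norm c = 1 + r"
    using lam0 norm_triangle_ineq2[of c lam0] by (simp add: norm_minus_commute)
  show ?thesis
  proof (rule that)
    show "0 < (1 + r) / (r * (1 + r + r + 1))"
      using r by simp
    show "(1 + r) / (r * (1 + r + r + 1)) * (norm (lam - lam0))\<^sup>2 \<le> \<bar>norm lam - 1\<bar>" if "lam \<in> closure D" for lam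
      using that r lam0 c D
      by (intro tangent_disk_quadratic) (auto simp: dist_norm norm_minus_commute)
  qed
qed

text \<open>
  Complements \<open>divisors_near_diophantine\<close>. The factor \<open>j\<close> on the left is what remains of the exponent
  \<open>2 * \<tau> + 1\<close>; it compensates a small \<open>\<kappa>\<close> when \<open>j\<close> is large.
\<close>

lemma divisors_tangent:
  fixes lam lam0 :: complex
  assumes "\<kappa> * (norm (lam - lam0))\<^sup>2 \<le> \<bar>norm lam - 1\<bar>" "0 \<le> \<kappa>" "1 \<le> j" "0 \<le> d"
    and far: "d * real j powr (- \<tau>) \<le> norm (lam - lam0)"
  shows "\<kappa> * d\<^sup>2 * real j \<le> real j powr (2 * \<tau> + 1) * norm (lam ^ j - 1)"
proof -
  have "real j powr (2 * \<tau> + 1) * (real j powr (- \<tau>))\<^sup>2 = real j"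
    using assms(3) by (simp add: power2_eq_square flip: powr_add)
  then have "\<kappa> * d\<^sup>2 * real j = real j powr (2 * \<tau> + 1) * (\<kappa> * (d * real j powr (- \<tau>))\<^sup>2)"
    by (simp add: power_mult_distrib mult_ac)
  also have "\<dots> \<le> real j powr (2 * \<tau> + 1) * (\<kappa> * (norm (lam - lam0))\<^sup>2)"
    using assms by (intro mult_left_mono power_mono) auto
  also have "\<dots> \<le> real j powr (2 * \<tau> + 1) * norm (lam ^ j - 1)"
    using order_trans[OF assms(1) norm_power_minus_one_ge[OF assms(3)]] by (intro mult_left_mono) auto
  finally show ?thesis .
qed

section \<open>Taylor remainders and power series\<close>

text \<open>
  The remainder estimate holds at every point where \<open>g\<close> obeys the same bound as on the disk, also far
  outside the disk, where the Taylor series says nothing about \<open>g\<close>. There \<open>\<bar>z - w\<bar>\<close> is at least a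
  multiple of \<open>R\<close>, and \<open>g\<close> and its Taylor polynomial can be estimated separately.
\<close>

lemma taylor_remainder_le:
  fixes g :: "complex \<Rightarrow> complex"
  assumes hol: "g holomorphic_on ball w R" and R: "0 < R"
    and M: "\<And>z. z \<in> ball w R \<Longrightarrow> norm (g z) \<le> M"
  shows norm_taylor_coeff_le: "norm ((deriv ^^ n) g w / fact n) \<le> M * (2 / R) ^ n"
    and "norm (g z) \<le> M \<Longrightarrow>
      norm (g z - (\<Sum>n<N. (deriv ^^ n) g w / fact n * (z - w) ^ n)) \<le> 3 * M * (4 / R) ^ N * norm (z - w) ^ N"
proof -
  define a where "a n = (deriv ^^ n) g w / fact n" for n
  \<comment> \<open>Half the radius leaves room for a closed disk; the factor of \<open>2\<close> is paid once more for a
    geometric series with ratio \<open>1 / 2\<close>.\<close>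
  have "cball w (R / 2) \<subseteq> ball w R"
    using R by auto
  then have hol2: "g holomorphic_on cball w (R / 2)"
    using hol holomorphic_on_subset by blast
  have "norm ((deriv ^^ n) g w) \<le> fact n * M / (R / 2) ^ n" for n
    using hol2 R
    by (intro Cauchy_inequality M holomorphic_on_imp_continuous_on)
      (auto simp: dist_norm intro: holomorphic_on_subset)
  then have "norm (a n) \<le> M * (2 / R) ^ n" for n
    by (simp add: a_def norm_divide field_simps power_divide)
  note a_le = this
  then show "norm ((deriv ^^ n) g w / fact n) \<le> M * (2 / R) ^ n"
    by (simp add: a_def)
  have M0: "0 \<le> M"
    using order_trans[OF norm_ge_zero M[of w]] R by simp
  assume gz: "norm (g z) \<le> M"
  define x where "x = 2 * norm (z - w) / R"
  have x0: "0 \<le> x" using R by (simp add: x_def)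
  have term_le: "norm (a n * (z - w) ^ n) \<le> M * x ^ n" for n
  proof -
    have "norm (a n) * norm (z - w) ^ n \<le> M * (2 / R) ^ n * norm (z - w) ^ n"
      by (intro mult_right_mono a_le) auto
    then show ?thesis
      by (simp add: norm_mult norm_power x_def power_mult_distrib power_divide mult_ac)
  qed
  have "norm (g z - (\<Sum>n<N. a n * (z - w) ^ n)) \<le> 3 * M * (2 * x) ^ N"
  proof (cases "x \<le> 1 / 2")
    case True
    have "2 * norm (z - w) \<le> R / 2"
      using True R by (simp add: x_def field_simps)
    then have "z \<in> ball w R"
      using R by (simp add: dist_norm norm_minus_commute)
    then have "(\<lambda>n. a n * (z - w) ^ n) sums g z"
      unfolding a_def by (rule holomorphic_power_series[OF hol])
    then have tail: "(\<lambda>n. a (n + N) * (z - w) ^ (n + N)) sums (g z - (\<Sum>n<N. a n * (z - w) ^ n))"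
      by (rule sums_split_initial_segment)
    have geo: "(\<lambda>n. M * x ^ N * (1 / 2) ^ n) sums (M * x ^ N * 2)"
      using geometric_sums[of "1 / 2 :: real"] by (intro sums_mult) simp
    have "norm (a (n + N) * (z - w) ^ (n + N)) \<le> M * x ^ N * (1 / 2) ^ n" for n
    proof -
      have "norm (a (n + N) * (z - w) ^ (n + N)) \<le> M * x ^ N * x ^ n"
        using term_le[of "n + N"] by (simp add: power_add mult_ac)
      also have "\<dots> \<le> M * x ^ N * (1 / 2) ^ n"
        using True x0 M0 by (intro mult_left_mono power_mono) auto
      finally show ?thesis .
    qed
    then have "norm (\<Sum>n. a (n + N) * (z - w) ^ (n + N)) \<le> (\<Sum>n. M * x ^ N * (1 / 2) ^ n)"
      using sums_summable[OF geo] by (rule norm_suminf_le)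
    then have "norm (g z - (\<Sum>n<N. a n * (z - w) ^ n)) \<le> M * x ^ N * 2"
      unfolding sums_unique[OF tail, symmetric] sums_unique[OF geo, symmetric] .
    also have "\<dots> \<le> 3 * M * x ^ N"
      using M0 x0 by simp
    also have "\<dots> \<le> 3 * M * (2 * x) ^ N"
      using M0 x0 by (intro mult_left_mono power_mono) auto
    finally show ?thesis .
  next
    case False
    define y where "y = 2 * x"
    have y: "1 \<le> y" using False by (simp add: y_def)
    have half: "(\<Sum>n<N. (1 / 2 :: real) ^ n) \<le> 2"
      using geometric_sum[of "1 / 2 :: real" N] by simp
    have "norm (\<Sum>n<N. a n * (z - w) ^ n) \<le> (\<Sum>n<N. M * y ^ N * (1 / 2) ^ n)"
    proof (rule sum_norm_le)
      fix n assume n: "n \<in> {..<N}"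
      have "x ^ n = (y * (1 / 2)) ^ n"
        by (simp add: y_def)
      then have "x ^ n = y ^ n * (1 / 2) ^ n"
        by (simp only: power_mult_distrib)
      also have "y ^ n * (1 / 2) ^ n \<le> y ^ N * (1 / 2) ^ n"
        using n y by (intro mult_right_mono power_increasing) auto
      finally have "M * x ^ n \<le> M * (y ^ N * (1 / 2) ^ n)"
        using M0 by (rule mult_left_mono)
      then show "norm (a n * (z - w) ^ n) \<le> M * y ^ N * (1 / 2) ^ n"
        using term_le[of n] by simp
    qed
    also have "\<dots> \<le> M * y ^ N * 2"
      unfolding sum_distrib_left[symmetric] using M0 y by (intro mult_left_mono half) auto
    finally have "norm (g z - (\<Sum>n<N. a n * (z - w) ^ n)) \<le> M + M * y ^ N * 2"
      using gz norm_triangle_ineq4[of "g z" "\<Sum>n<N. a n * (z - w) ^ n"] by linarith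
    moreover have "M * 1 \<le> M * y ^ N"
      using M0 y by (intro mult_left_mono one_le_power) auto
    ultimately show ?thesis by (simp add: y_def)
  qed
  also have "2 * x = 4 / R * norm (z - w)"
    by (simp add: x_def)
  also have "(4 / R * norm (z - w)) ^ N = (4 / R) ^ N * norm (z - w) ^ N"
    by (rule power_mult_distrib)
  finally show "norm (g z - (\<Sum>n<N. (deriv ^^ n) g w / fact n * (z - w) ^ n))
      \<le> 3 * M * (4 / R) ^ N * norm (z - w) ^ N"
    by (simp add: a_def mult_ac)
qed

text \<open>
  Restrict Euler's integral \<open>\<integral>t\<^sup>x exp(-t) dt\<close> to the interval from \<open>a\<close> to \<open>a + 1\<close>.
\<close>

lemma powr_le_exp_Gamma:
  fixes a x :: real
  assumes "0 \<le> a" "0 \<le> x"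
  shows "a powr x \<le> exp (a + 1) * Gamma (1 + x)"
proof -
  define c where "c = a powr x * exp (- (a + 1))"
  have "((\<lambda>t. c) has_integral c) {a..a + 1}"
    using has_integral_const_real[of c a "a + 1"] by simp
  then have "((\<lambda>t. if t \<in> {a..a + 1} then c else 0) has_integral c) {0..}"
    using assms(1) by (subst has_integral_restrict) auto
  moreover have "((\<lambda>t. t powr (1 + x - 1) / exp t) has_integral Gamma (1 + x)) {0..}"
    using assms(2) by (intro Gamma_integral_real) auto
  ultimately have "c \<le> Gamma (1 + x)"
  proof (rule has_integral_le)
    fix t :: real assume "t \<in> {0..}"
    have "a powr x * exp (- (a + 1)) \<le> t powr x * exp (- t)" if "a \<le> t" "t \<le> a + 1"
      using that assms by (intro mult_mono powr_mono2) auto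
    then show "(if t \<in> {a..a + 1} then c else 0) \<le> t powr (1 + x - 1) / exp t"
      by (auto simp: c_def exp_minus field_simps)
  qed
  then have "c * exp (a + 1) \<le> Gamma (1 + x) * exp (a + 1)"
    by simp
  then show ?thesis
    by (simp add: c_def mult_ac flip: exp_add)
qed

text \<open>
  With \<open>E * r \<le> 1 / 2\<close> the series is dominated by a geometric series with ratio \<open>1 / 2\<close>. Nonnegativity of
  \<open>Hinf_norm\<close> needs an argument, since the supremum of an unbounded set of reals is unspecified.
\<close>

lemma
  fixes u :: "nat \<Rightarrow> complex" and F :: "complex \<Rightarrow> complex"
  assumes "0 < r" "0 \<le> E" and Er: "E * r \<le> 1 / 2"
    and u: "\<And>k. norm (u k) \<le> Q * E ^ k"
    and F: "\<And>z. z \<in> ball 0 r \<Longrightarrow> (\<lambda>k. u k * z ^ k) sums F z"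
  shows norm_power_series_le: "\<And>z. z \<in> ball 0 r \<Longrightarrow> norm (F z) \<le> 2 * Q"
    and Hinf_norm_power_series_le: "Hinf_norm r F \<le> 2 * Q"
    and Hinf_norm_power_series_nonneg: "0 \<le> Hinf_norm r F"
proof -
  have Q: "0 \<le> Q"
    using order_trans[OF norm_ge_zero u[of 0]] by simp
  show le: "norm (F z) \<le> 2 * Q" if z: "z \<in> ball 0 r" for z
  proof -
    have geo: "(\<lambda>k. Q * (1 / 2) ^ k) sums (Q * 2)"
      using geometric_sums[of "1 / 2 :: real"] by (intro sums_mult) simp
    have "norm (u k * z ^ k) \<le> Q * (1 / 2) ^ k" for k
    proof -
      have "E * norm z \<le> E * r"
        using z assms(2) by (intro mult_left_mono) auto
      have "norm (u k * z ^ k) \<le> Q * E ^ k * norm z ^ k"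
        unfolding norm_mult norm_power by (intro mult_right_mono u) auto
      also have "\<dots> = Q * (E * norm z) ^ k"
        by (simp only: power_mult_distrib mult.assoc)
      also have "\<dots> \<le> Q * (1 / 2) ^ k"
        using Q Er assms(2) \<open>E * norm z \<le> E * r\<close> by (intro mult_left_mono power_mono) auto
      finally show ?thesis .
    qed
    then have "norm (\<Sum>k. u k * z ^ k) \<le> (\<Sum>k. Q * (1 / 2) ^ k)"
      using sums_summable[OF geo] by (rule norm_suminf_le)
    then show ?thesis
      unfolding sums_unique[OF F[OF z], symmetric] sums_unique[OF geo, symmetric] by simp
  qed
  show "Hinf_norm r F \<le> 2 * Q"
    unfolding Hinf_norm_def using assms(1) le by (intro cSUP_least) auto
  have "norm (F 0) \<le> Hinf_norm r F"
    unfolding Hinf_norm_def using assms(1) le by (intro cSUP_upper bdd_aboveI2[of _ _ "2 * Q"]) auto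
  then show "0 \<le> Hinf_norm r F"
    using norm_ge_zero order_trans by blast
qed

lemma
  fixes H :: "complex fps"
  assumes "0 < r" "0 \<le> E" "E * r \<le> 1 / 2"
    and u: "\<And>k. norm (fps_nth H k) \<le> Q * E ^ k"
  shows fps_in_HinfI: "fps_in_Hinf H r"
    and eval_fps_sums: "z \<in> ball 0 r \<Longrightarrow> (\<lambda>k. fps_nth H k * z ^ k) sums eval_fps H z"
proof -
  have rad: "ereal r \<le> fps_conv_radius H"
    unfolding fps_conv_radius_def
  proof (rule conv_radius_geI_ex')
    fix x :: real assume x: "0 < x" "ereal x < ereal r"
    have Q: "0 \<le> Q"
      using order_trans[OF norm_ge_zero u[of 0]] by simp
    have Ex: "E * x \<le> 1 / 2"
      using mult_left_mono[of x r E] assms x by simp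
    show "summable (\<lambda>n. fps_nth H n * of_real x ^ n)"
    proof (rule summable_comparison_test')
      show "summable (\<lambda>n. Q * (1 / 2 :: real) ^ n)"
        by (intro summable_mult summable_geometric) simp
      fix n :: nat
      have "norm (fps_nth H n * of_real x ^ n) \<le> Q * E ^ n * x ^ n"
        using x by (auto simp: norm_mult norm_power intro!: mult_right_mono u)
      also have "\<dots> = Q * (E * x) ^ n"
        by (simp only: power_mult_distrib mult.assoc)
      also have "\<dots> \<le> Q * (1 / 2) ^ n"
        using Q Ex x assms(2) by (intro mult_left_mono power_mono) auto
      finally show "norm (fps_nth H n * of_real x ^ n) \<le> Q * (1 / 2) ^ n" .
    qed
  qed
  have sums: "(\<lambda>k. fps_nth H k * z ^ k) sums eval_fps H z" if "z \<in> ball 0 r" for z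
  proof -
    have "ereal (norm z) < fps_conv_radius H"
      using that rad by (auto elim: less_le_trans[rotated])
    then show ?thesis
      unfolding eval_fps_def by (intro summable_sums summable_fps)
  qed
  then show "z \<in> ball 0 r \<Longrightarrow> (\<lambda>k. fps_nth H k * z ^ k) sums eval_fps H z" .
  have "eval_fps H holomorphic_on ball 0 r"
    using ball_eball_mono[OF rad] by (intro holomorphic_on_eval_fps) auto
  moreover have "bounded (eval_fps H ` ball 0 r)"
    unfolding bounded_iff using norm_power_series_le[OF assms sums] by blast
  ultimately show "fps_in_Hinf H r"
    using rad by (simp add: fps_in_Hinf_def Hinf_def)
qed

section \<open>Gevrey expansion of the linearization\<close>

text \<open>
  The two hypotheses on the divisors have different purposes. On \<open>closure S\<close> they make the
  linearization converge and depend holomorphically on the parameter; around \<open>lam0\<close> they bound the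
  coefficient of \<open>z ^ k\<close> on a disk on which the Cauchy inequalities apply. The shrinking of these disks
  like \<open>k powr (- \<tau>)\<close> is the source of the Gevrey exponent. The geometry of \<open>S\<close> enters the radius only
  through \<open>C\<close> and \<open>\<mu>\<close>, so that one radius serves all domains with the same lower bound.
\<close>

lemma linearization_gevreyI:
  fixes f :: "nat \<Rightarrow> complex" and B C \<mu> \<tau> d :: real and S :: "complex set" and lam0 :: complex
  defines "A \<equiv> 64 * B * C * 16 powr \<mu>"
  assumes B: "1 \<le> B" and f: "\<And>j. 2 \<le> j \<Longrightarrow> norm (f j) \<le> B ^ (j - 1)"
    and C: "1 \<le> C" and \<mu>: "0 \<le> \<mu>" and \<tau>: "0 \<le> \<tau>" and d: "0 < d" and S: "open S"
    and div_S: "\<And>lam j. lam \<in> closure S \<Longrightarrow> 1 \<le> j \<Longrightarrow> 1 \<le> C * real j powr \<mu> * norm (lam ^ j - 1)"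
    and div_near: "\<And>lam j. 1 \<le> j \<Longrightarrow> norm (lam - lam0) \<le> d * real j powr (- \<tau>) \<Longrightarrow>
      1 \<le> C * real j powr \<mu> * norm (lam ^ j - 1)"
  shows "linearization_gevrey f \<tau> (exp (- 2) / A) S lam0"
proof -
  define h where "h k lam = lin_coeff f lam k" for k lam
  \<comment> \<open>One factor \<open>exp (- 1)\<close> of the radius compensates the exponential growth that the estimate by
    the Gamma function costs, the other one makes the series converge.\<close>
  define r where "r = exp (- 2) / A"
  \<comment> \<open>The shift by one avoids a disk of radius \<open>0\<close> for \<open>k = 0\<close>.\<close>
  define R where "R k = d * real (Suc k) powr (- \<tau>)" for k
  define W where "W n = exp 2 * (4 / d) ^ n * Gamma (1 + real n * \<tau>)" for n
  define E where "E = A * exp 1"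
  have "1 * 1 * 1 \<le> B * C * 16 powr \<mu>"
    using B C \<mu> by (intro mult_mono ge_one_powr_ge_zero) auto
  then have A: "64 \<le> A"
    by (simp add: A_def)
  have r: "0 < r" using A by (simp add: r_def)
  have E0: "0 \<le> E" using A by (simp add: E_def)
  have AE: "A \<le> E"
    using A mult_left_mono[of 1 "exp 1" A] by (simp add: E_def)
  have "E * r = exp (- 1)"
    using A by (simp add: E_def r_def exp_add[symmetric])
  also have "\<dots> \<le> 1 / 2"
    using exp_ge_add_one_self[of 1] by (simp add: exp_minus field_simps)
  finally have Er: "E * r \<le> 1 / 2" .
  have Ar: "A * r \<le> 1 / 2"
    using order_trans[OF mult_right_mono[OF AE, of r] Er] r by simp
  have A0: "0 \<le> A" using A by simp
  have Rpos: "0 < R k" for k using d by (simp add: R_def)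

  have h_S: "norm (h k lam) \<le> A ^ k" if "lam \<in> closure S" for k lam
    unfolding h_def A_def using that
    by (intro norm_lin_coeff_le[where n = k] B f C \<mu> div_S) auto
  have div_ball: "1 \<le> C * real j powr \<mu> * norm (lam ^ j - 1)"
    if "lam \<in> ball lam0 (R k)" "1 \<le> j" "j < k" for lam j k
  proof (rule div_near)
    have "R k \<le> d * real j powr (- \<tau>)"
      unfolding R_def using that d \<tau> by (intro mult_left_mono powr_mono2') auto
    then show "norm (lam - lam0) \<le> d * real j powr (- \<tau>)"
      using that(1) by (simp add: dist_norm norm_minus_commute)
  qed (use that in auto)
  have h_ball: "norm (h k lam) \<le> A ^ k" if "lam \<in> ball lam0 (R k)" for k lam
    unfolding h_def A_def using that
    by (intro norm_lin_coeff_le[where n = k] B f C \<mu> div_ball) auto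
  have hol_ball: "h k holomorphic_on ball lam0 (R k)" for k
    unfolding h_def using div_ball by (intro lin_coeff_holomorphic) force
  have hol_S: "h k holomorphic_on S" for k
    unfolding h_def using div_S closure_subset by (intro lin_coeff_holomorphic) force
  have R_le: "(4 / R k) ^ n \<le> W n * exp 1 ^ k" for n k
  proof -
    have "4 / R k = 4 / d * real (Suc k) powr \<tau>"
      by (simp add: R_def powr_minus field_simps)
    then have "(4 / R k) ^ n = (4 / d) ^ n * (real (Suc k) powr \<tau>) ^ n"
      by (simp only: power_mult_distrib)
    also have "(real (Suc k) powr \<tau>) ^ n = real (Suc k) powr (real n * \<tau>)"
      by (simp add: powr_realpow[symmetric] powr_powr mult.commute)
    also have "\<dots> \<le> exp (real (Suc k) + 1) * Gamma (1 + real n * \<tau>)"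
      using \<tau> by (intro powr_le_exp_Gamma) auto
    also have "exp (real (Suc k) + 1) = exp 2 * exp 1 ^ k"
      by (simp add: exp_of_nat_mult[symmetric] exp_add[symmetric])
    finally show ?thesis
      using d by (simp add: W_def mult_ac)
  qed
  have W0: "0 \<le> W n" for n
    using order_trans[OF _ R_le[of 0 n]] Rpos[of 0] by simp

  have in_Hinf: "fps_in_Hinf (linearization f lam) r" if "lam \<in> closure S" for lam
    by (rule fps_in_HinfI[OF r A0 Ar, of _ 1])
      (use h_S[OF that] in \<open>simp add: linearization_def h_def\<close>)
  have lin_sums: "(\<lambda>k. h k lam * z ^ k) sums eval_fps (linearization f lam) z"
    if "lam \<in> closure S" "z \<in> ball 0 r" for lam z
    using eval_fps_sums[OF r A0 Ar, of "linearization f lam" 1 z] h_S[OF that(1)] that(2)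
    by (simp add: linearization_def h_def)

  have "vholomorphic_on (Hinf r) (Hinf_norm r) (\<lambda>lam. eval_fps (linearization f lam)) S"
    unfolding vholomorphic_on_def
  proof (intro conjI ballI)
    show "(\<lambda>lam. eval_fps (linearization f lam)) ` S \<subseteq> Hinf r"
      using in_Hinf closure_subset by (auto simp: fps_in_Hinf_def)
  next
    fix lam assume lam: "lam \<in> S"
    then obtain s where s: "0 < s" "ball lam s \<subseteq> S"
      using S openE by blast
    have lam_cl: "mu \<in> closure S" if "mu \<in> S" for mu
      using that closure_subset by blast
    have hol: "h k holomorphic_on ball lam s" for k
      using hol_S s holomorphic_on_subset by blast
    have bound: "norm (h k mu) \<le> A ^ k" if "mu \<in> ball lam s" for k mu
      using that s lam_cl h_S by blast
    \<comment> \<open>The derivative is taken coefficientwise. The quadratic Taylor remainder on a disk around \<open>lam\<close>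
      inside \<open>S\<close> makes the difference quotients converge uniformly in \<open>z\<close>.\<close>
    define D where "D = Abs_fps (\<lambda>k. deriv (h k) lam)"
    have D_le: "norm (fps_nth D k) \<le> 2 / s * A ^ k" for k
      using norm_taylor_coeff_le[OF hol s(1) bound, of 1 k] by (simp add: D_def mult.commute)
    show "\<exists>g\<in>Hinf r. ((\<lambda>mu. Hinf_norm r (\<lambda>x. (eval_fps (linearization f mu) x
        - eval_fps (linearization f lam) x) / (mu - lam) - g x)) \<longlongrightarrow> 0) (at lam within S)"
    proof
      show "eval_fps D \<in> Hinf r"
        using fps_in_HinfI[OF r A0 Ar D_le] by (simp add: fps_in_Hinf_def)
      have bounds: "Hinf_norm r (\<lambda>x. (eval_fps (linearization f mu) x
          - eval_fps (linearization f lam) x) / (mu - lam) - eval_fps D x) \<in> {0..96 / s\<^sup>2 * norm (mu - lam)}"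
        if mu: "mu \<in> S" "mu \<noteq> lam" for mu
      proof -
        define u where "u k = (h k mu - h k lam) / (mu - lam) - deriv (h k) lam" for k
        have u: "norm (u k) \<le> 48 / s\<^sup>2 * norm (mu - lam) * A ^ k" for k
        proof -
          have "norm (h k mu - (\<Sum>n<2. (deriv ^^ n) (h k) lam / fact n * (mu - lam) ^ n))
              \<le> 3 * A ^ k * (4 / s) ^ 2 * norm (mu - lam) ^ 2"
            by (rule taylor_remainder_le(2)[OF hol s(1) bound]) (use h_S lam_cl mu in auto)
          moreover have "h k mu - (\<Sum>n<2. (deriv ^^ n) (h k) lam / fact n * (mu - lam) ^ n) = u k * (mu - lam)"
            using mu by (simp add: u_def numeral_2_eq_2 field_simps)
          ultimately have "norm (u k) * norm (mu - lam)
              \<le> (48 / s\<^sup>2 * norm (mu - lam) * A ^ k) * norm (mu - lam)"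
            by (simp add: norm_mult power_divide power2_eq_square mult_ac)
          then show ?thesis
            by (rule mult_right_le_imp_le) (use mu in auto)
        qed
        have sums: "(\<lambda>k. u k * z ^ k) sums ((eval_fps (linearization f mu) z
          - eval_fps (linearization f lam) z) / (mu - lam) - eval_fps D z)" if z: "z \<in> ball 0 r" for z
        proof -
          have "(\<lambda>k. (h k mu * z ^ k - h k lam * z ^ k) / (mu - lam) - fps_nth D k * z ^ k)
              sums ((eval_fps (linearization f mu) z - eval_fps (linearization f lam) z) / (mu - lam) - eval_fps D z)"
            using lam_cl mu lam z
            by (intro sums_diff sums_divide lin_sums eval_fps_sums[OF r A0 Ar D_le]) auto
          then show ?thesis
            by (simp add: u_def D_def algebra_simps diff_divide_distrib)
        qed
        show ?thesis
          using Hinf_norm_power_series_le[OF r A0 Ar u sums]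
            Hinf_norm_power_series_nonneg[OF r A0 Ar u sums] by simp
      qed
      have "((\<lambda>mu. 96 / s\<^sup>2 * norm (mu - lam)) \<longlongrightarrow> 96 / s\<^sup>2 * norm (lam - lam)) (at lam within S)"
        by (intro tendsto_intros)
      then have lim: "((\<lambda>mu. 96 / s\<^sup>2 * norm (mu - lam)) \<longlongrightarrow> 0) (at lam within S)"
        by simp
      show "((\<lambda>mu. Hinf_norm r (\<lambda>x. (eval_fps (linearization f mu) x
          - eval_fps (linearization f lam) x) / (mu - lam) - eval_fps D x)) \<longlongrightarrow> 0) (at lam within S)"
        by (rule tendsto_sandwich[OF _ _ tendsto_const lim])
          (use bounds in \<open>auto simp: eventually_at_filter\<close>)
    qed
  qed
  moreover have "\<exists>c b1 b2. range c \<subseteq> Hinf r \<and> 0 < b1 \<and> 0 < b2 \<and>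
      (\<forall>n. \<forall>lam\<in>S. Hinf_norm r (\<lambda>x. eval_fps (linearization f lam) x - (\<Sum>k<n. c k x * (lam - lam0) ^ k))
        \<le> b1 * b2 ^ n * Gamma (1 + real n * \<tau>) * norm (lam - lam0) ^ n)"
  proof -
    define a where "a n k = (deriv ^^ n) (h k) lam0 / fact n" for n k
    define c where "c n = eval_fps (Abs_fps (a n))" for n
    have a_le: "norm (fps_nth (Abs_fps (a n)) k) \<le> W n * E ^ k" for n k
    proof -
      have "norm (a n k) \<le> A ^ k * (2 / R k) ^ n"
        unfolding a_def by (rule norm_taylor_coeff_le[OF hol_ball Rpos h_ball])
      also have "\<dots> \<le> A ^ k * (4 / R k) ^ n"
        using A0 Rpos[of k] by (intro mult_left_mono power_mono divide_right_mono) auto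
      also have "\<dots> \<le> A ^ k * (W n * exp 1 ^ k)"
        using A0 by (intro mult_left_mono R_le) auto
      also have "\<dots> = W n * E ^ k"
        by (simp add: E_def power_mult_distrib mult_ac)
      finally show ?thesis by simp
    qed
    have "c n \<in> Hinf r" for n
      using fps_in_HinfI[OF r E0 Er a_le] by (simp add: c_def fps_in_Hinf_def)
    moreover have "Hinf_norm r (\<lambda>x. eval_fps (linearization f lam) x - (\<Sum>k<n. c k x * (lam - lam0) ^ k))
        \<le> 6 * exp 2 * (4 / d) ^ n * Gamma (1 + real n * \<tau>) * norm (lam - lam0) ^ n"
      if lam: "lam \<in> S" for n lam
    proof -
      define u where "u k = h k lam - (\<Sum>m<n. a m k * (lam - lam0) ^ m)" for k
      have lam_cl: "lam \<in> closure S" using lam closure_subset by blast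
      have u: "norm (u k) \<le> 3 * W n * norm (lam - lam0) ^ n * E ^ k" for k
      proof -
        have "norm (u k) \<le> 3 * A ^ k * (4 / R k) ^ n * norm (lam - lam0) ^ n"
          unfolding u_def a_def
          by (rule taylor_remainder_le(2)[OF hol_ball Rpos h_ball h_S[OF lam_cl]])
        also have "\<dots> \<le> 3 * A ^ k * (W n * exp 1 ^ k) * norm (lam - lam0) ^ n"
          using A0 by (intro mult_left_mono mult_right_mono R_le) auto
        also have "\<dots> = 3 * W n * norm (lam - lam0) ^ n * E ^ k"
          by (simp add: E_def power_mult_distrib mult_ac)
        finally show ?thesis .
      qed
      have sums: "(\<lambda>k. u k * z ^ k) sums
          (eval_fps (linearization f lam) z - (\<Sum>m<n. c m z * (lam - lam0) ^ m))"
        if z: "z \<in> ball 0 r" for z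
      proof -
        have "(\<lambda>k. h k lam * z ^ k - (\<Sum>m<n. fps_nth (Abs_fps (a m)) k * z ^ k * (lam - lam0) ^ m)) sums
            (eval_fps (linearization f lam) z - (\<Sum>m<n. c m z * (lam - lam0) ^ m))"
          unfolding c_def using lam_cl z
          by (intro sums_diff sums_sum sums_mult2 lin_sums eval_fps_sums[OF r E0 Er a_le]) auto
        then show ?thesis
          by (simp add: u_def algebra_simps sum_distrib_left)
      qed
      have "Hinf_norm r (\<lambda>x. eval_fps (linearization f lam) x - (\<Sum>m<n. c m x * (lam - lam0) ^ m))
          \<le> 2 * (3 * W n * norm (lam - lam0) ^ n)"
        by (rule Hinf_norm_power_series_le[OF r E0 Er u sums])
      then show ?thesis
        by (simp add: W_def mult_ac)
    qed
    ultimately show ?thesis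
      using d by (intro exI[of _ c] exI[of _ "6 * exp 2"] exI[of _ "4 / d"]) auto
  qed
  ultimately show ?thesis
    unfolding linearization_gevrey_def gevrey_expansion_def r_def[symmetric]
    using in_Hinf by (intro conjI ballI)
qed

theorem theoremB:
  fixes f :: "nat \<Rightarrow> complex" and \<alpha>0 \<tau>0 :: real and lam0 :: complex
  assumes "\<And>lam. lam \<noteq> 0 \<Longrightarrow> univalent_on_disk (germ f lam) 1"
    and "diophantine \<tau>0 \<alpha>0"
    and "lam0 = exp (2 * of_real pi * \<i> * of_real \<alpha>0)"
  shows "\<exists>\<rho>>0. \<forall>Dm Dp. inner_tangent_disk lam0 Dm \<longrightarrow> outer_tangent_disk lam0 Dp \<longrightarrow>
           (\<exists>\<delta>>0. linearization_gevrey f \<tau>0 \<rho> ((Dp \<union> Dm) \<inter> ball lam0 \<delta>) lam0) \<and>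
           (\<exists>\<rho>'>0. linearization_gevrey f \<tau>0 \<rho>' (Dp \<union> Dm) lam0)"
proof -
  have "1 \<le> fps_conv_radius (germ f 1)"
    using assms(1)[of 1] by (simp add: univalent_on_disk_def one_ereal_def)
  then obtain B where B: "1 \<le> B" and B': "\<And>j. 2 \<le> j \<Longrightarrow> norm (fps_nth (germ f 1) j) \<le> B ^ (j - 1)"
    by (rule geometric_bound_of_conv_radius) blast
  have f: "norm (f j) \<le> B ^ (j - 1)" if "2 \<le> j" for j
    using B'[OF that] that by (simp add: germ_def)
  have \<tau>: "2 \<le> \<tau>0" using assms(2) by (simp add: diophantine_def)
  have norm_lam0: "norm lam0 = 1"
    using norm_exp_i_times[of "2 * pi * \<alpha>0"] by (simp add: assms(3) mult_ac)
  obtain c where c: "0 < c" and dio: "\<And>j. 1 \<le> j \<Longrightarrow> c * real j powr (1 - \<tau>0) \<le> norm (lam0 ^ j - 1)"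
    using diophantine_divisors[OF assms(2)] unfolding assms(3) by blast
  define d where "d = min 1 (c / 6)"
  have d: "0 < d" "d \<le> 1" "6 * d \<le> c" using c by (auto simp: d_def)
  \<comment> \<open>The tangent disks alone require \<open>2 * \<tau>0\<close>; the additional \<open>1\<close> makes the radius near \<open>lam0\<close>
    independent of the disks.\<close>
  define \<mu> where "\<mu> = 2 * \<tau>0 + 1"
  define C where "C = max 1 (2 / c)"
  have C: "1 \<le> C" "1 \<le> C * (c / 2)"
    using c by (auto simp: C_def max_def field_simps)
  have \<mu>: "0 \<le> \<mu>" using \<tau> by (simp add: \<mu>_def)
  have near: "1 \<le> C * real j powr \<mu> * norm (lam ^ j - 1)"
    if j: "1 \<le> j" and le: "norm (lam - lam0) \<le> d * real j powr (- \<tau>0)" for lam j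
  proof -
    have "1 * 1 \<le> C * (c / 2) * real j powr (\<mu> + (1 - \<tau>0))"
      using C j \<tau> by (intro mult_mono ge_one_powr_ge_zero) (auto simp: \<mu>_def)
    also have "\<dots> = C * real j powr \<mu> * (c / 2 * real j powr (1 - \<tau>0))"
      by (simp only: powr_add mult_ac)
    also have "\<dots> \<le> C * real j powr \<mu> * norm (lam ^ j - 1)"
      using C j \<tau> d by (intro mult_left_mono divisors_near_diophantine[OF norm_lam0 dio[OF j] _ j _ _ _ le]) auto
    finally show ?thesis by simp
  qed
  define A where "A K = 64 * B * K * 16 powr \<mu>" for K
  have A: "0 < exp (- 2) / A K" if "1 \<le> K" for K
    using B that by (simp add: A_def)
  have criterion: "linearization_gevrey f \<tau>0 (exp (- 2) / A K) S lam0"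
    if "C \<le> K" "open S" and S: "\<And>lam j. lam \<in> closure S \<Longrightarrow> 1 \<le> j \<Longrightarrow>
      d * real j powr (- \<tau>0) < norm (lam - lam0) \<Longrightarrow> 1 \<le> K * real j powr \<mu> * norm (lam ^ j - 1)" for K S
  proof -
    have near': "1 \<le> K * real j powr \<mu> * norm (lam ^ j - 1)"
      if "1 \<le> j" "norm (lam - lam0) \<le> d * real j powr (- \<tau>0)" for lam j
      using near[OF that] \<open>C \<le> K\<close>
      by (elim order_trans) (auto intro!: mult_right_mono)
    have all: "1 \<le> K * real j powr \<mu> * norm (lam ^ j - 1)" if "lam \<in> closure S" "1 \<le> j" for lam j
      using S[OF that] near'[OF that(2), of lam] by linarith
    have "1 \<le> K" "0 \<le> \<tau>0" using C \<open>C \<le> K\<close> \<tau> by auto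
    from linearization_gevreyI[OF B f this(1) \<mu> this(2) d(1) \<open>open S\<close> all near']
    show ?thesis unfolding A_def .
  qed
  show ?thesis
  proof (rule exI[of _ "exp (- 2) / A C"], intro conjI allI impI)
    show "0 < exp (- 2) / A C" by (rule A[OF C(1)])
  next
    fix Dm Dp
    assume "inner_tangent_disk lam0 Dm" "outer_tangent_disk lam0 Dp"
    note disks = this
    obtain \<kappa>1 where \<kappa>1: "0 < \<kappa>1" "\<And>lam. lam \<in> closure Dm \<Longrightarrow> \<kappa>1 * (norm (lam - lam0))\<^sup>2 \<le> \<bar>norm lam - 1\<bar>"
      using inner_tangent_disk_quadratic[OF disks(1)] by blast
    obtain \<kappa>2 where \<kappa>2: "0 < \<kappa>2" "\<And>lam. lam \<in> closure Dp \<Longrightarrow> \<kappa>2 * (norm (lam - lam0))\<^sup>2 \<le> \<bar>norm lam - 1\<bar>"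
      using outer_tangent_disk_quadratic[OF disks(2)] by blast
    define \<kappa> where "\<kappa> = min \<kappa>1 \<kappa>2"
    have \<kappa>: "0 < \<kappa>" using \<kappa>1 \<kappa>2 by (simp add: \<kappa>_def)
    have quad: "\<kappa> * (norm (lam - lam0))\<^sup>2 \<le> \<bar>norm lam - 1\<bar>" if "lam \<in> closure (Dp \<union> Dm)" for lam
    proof -
      have "\<kappa> * (norm (lam - lam0))\<^sup>2 \<le> \<kappa>1 * (norm (lam - lam0))\<^sup>2"
        "\<kappa> * (norm (lam - lam0))\<^sup>2 \<le> \<kappa>2 * (norm (lam - lam0))\<^sup>2"
        by (auto simp: \<kappa>_def intro!: mult_right_mono)
      then show ?thesis
        using that \<kappa>1(2)[of lam] \<kappa>2(2)[of lam] by (auto simp: closure_Un)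
    qed
    have "open (Dp \<union> Dm)"
      using disks by (auto simp: inner_tangent_disk_def outer_tangent_disk_def)
    define L where "L = \<kappa> * d\<^sup>2"
    have L: "0 < L" using \<kappa> d by (simp add: L_def)
    have far: "L * real j \<le> real j powr \<mu> * norm (lam ^ j - 1)"
      if "lam \<in> closure (Dp \<union> Dm)" "1 \<le> j" "d * real j powr (- \<tau>0) < norm (lam - lam0)" for lam j
      unfolding L_def \<mu>_def
      by (rule divisors_tangent[OF quad]) (use that \<kappa> d in auto)
    \<comment> \<open>On the whole disks the constant has to depend on the disks, through \<open>L\<close>.\<close>
    define K where "K = max C (1 / L)"
    have K: "C \<le> K" "1 \<le> K" "1 / L \<le> K" using C by (auto simp: K_def)
    show "\<exists>\<rho>'>0. linearization_gevrey f \<tau>0 \<rho>' (Dp \<union> Dm) lam0"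
    proof (intro exI conjI)
      show "0 < exp (- 2) / A K" by (rule A[OF K(2)])
      show "linearization_gevrey f \<tau>0 (exp (- 2) / A K) (Dp \<union> Dm) lam0"
      proof (rule criterion[OF K(1) \<open>open (Dp \<union> Dm)\<close>])
        fix lam j assume *: "lam \<in> closure (Dp \<union> Dm)" "(1::nat) \<le> j" "d * real j powr (- \<tau>0) < norm (lam - lam0)"
        have "1 \<le> 1 / L * (L * real j)" using L *(2) by simp
        also have "\<dots> \<le> K * (real j powr \<mu> * norm (lam ^ j - 1))"
          using K L by (intro mult_mono[OF _ far[OF *]]) auto
        finally show "1 \<le> K * real j powr \<mu> * norm (lam ^ j - 1)"
          by (simp add: mult.assoc)
      qed
    qed
    \<comment> \<open>Within distance \<open>\<delta>\<close> of \<open>lam0\<close> the diophantine estimate fails only for \<open>j \<ge> J\<close>, and then the factor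
    \<open>j\<close> in \<open>far\<close> outweighs \<open>L\<close>.\<close>
    define J where "J = nat \<lceil>1 / L\<rceil>"
    have "1 / L \<le> real J"
      unfolding J_def by (rule real_nat_ceiling_ge)
    moreover have "0 < 1 / L" using L by simp
    ultimately have J: "1 / L \<le> real J" "1 \<le> J"
      by linarith+
    define \<delta> where "\<delta> = d * real J powr (- \<tau>0)"
    have \<delta>: "0 < \<delta>" using d J by (simp add: \<delta>_def)
    show "\<exists>\<delta>>0. linearization_gevrey f \<tau>0 (exp (- 2) / A C) ((Dp \<union> Dm) \<inter> ball lam0 \<delta>) lam0"
    proof (intro exI conjI)
      show "0 < \<delta>" by (rule \<delta>)
      show "linearization_gevrey f \<tau>0 (exp (- 2) / A C) ((Dp \<union> Dm) \<inter> ball lam0 \<delta>) lam0"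
      proof (rule criterion)
        show "open ((Dp \<union> Dm) \<inter> ball lam0 \<delta>)"
          using \<open>open (Dp \<union> Dm)\<close> by blast
        fix lam j assume *: "lam \<in> closure ((Dp \<union> Dm) \<inter> ball lam0 \<delta>)" "(1::nat) \<le> j"
          "d * real j powr (- \<tau>0) < norm (lam - lam0)"
        have cl: "lam \<in> closure (Dp \<union> Dm)"
          using *(1) closure_mono[of "(Dp \<union> Dm) \<inter> ball lam0 \<delta>" "Dp \<union> Dm"] by blast
        have "lam \<in> closure (ball lam0 \<delta>)"
          using *(1) closure_mono[of "(Dp \<union> Dm) \<inter> ball lam0 \<delta>" "ball lam0 \<delta>"] by blast
        then have "norm (lam - lam0) \<le> \<delta>"
          using closure_ball[OF \<delta>, of lam0] by (auto simp: dist_norm norm_minus_commute)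
        then have "real j powr (- \<tau>0) < real J powr (- \<tau>0)"
          using less_le_trans[OF *(3), of \<delta>] d by (simp add: \<delta>_def)
        then have "J \<le> j"
          using powr_mono2'[of "- \<tau>0" "real j" "real J"] \<tau> *(2) by (cases "J \<le> j") simp_all
        then have "1 / L \<le> real j" using J by linarith
        then have "1 \<le> L * real j" using L by (simp add: field_simps)
        also have "\<dots> \<le> real j powr \<mu> * norm (lam ^ j - 1)"
          by (rule far[OF cl *(2,3)])
        also have "1 * (real j powr \<mu> * norm (lam ^ j - 1)) \<le> C * (real j powr \<mu> * norm (lam ^ j - 1))"
          using C by (intro mult_right_mono) auto
        finally show "1 \<le> C * real j powr \<mu> * norm (lam ^ j - 1)"
          by (simp add: mult.assoc)
      qed auto
    qed
  qed
qed

end
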